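(* Let $\Bbbk\in\{\mathbb{R},\mathbb{C}\}$, let $\mathcal{X}\subseteq\Bbbk^n$ be a model given as in (IS) or (ES), let $d=\dim\mathcal{X}$, and let $1\le s\le n$. There exists a coordinate projection $\hat\mu:\Bbbk^n\to\Bbbk^s$ whose restriction $\mu=\hat\mu|_{\mathcal{X}}$ is generically recoverable if and only if $s\ge d$.
   Context: The model is given in one of two ways. (IS): $\mathcal{X}=\{x\in\Bbbk^n: f_1(x)=\dots=f_k(x)=0\}$ for polynomials $f_i\in\Bbbk[x_1,\dots,x_n]$; in this case $\mathcal X$ is assumed irreducible (nonempty and not a union of two proper algebraic subvarieties). (ES): $\mathcal{X}=\phi(\Bbbk^\ell)$ for a polynomial map $\phi:\Bbbk^\ell\to\Bbbk^n$ (the Zariski closure is then automatically irreducible). $\overline{\mathcal{X}}$ is the Zariski closure of $\mathcal{X}$ in $\Bbbk^n$, and $\dim\mathcal{X}=\dim\overline{\mathcal X}$ is its dimension as an algebraic variety over $\Bbbk$ (in (ES): the maximal rank of the Jacobian matrix of $\phi$). A coordinate projection $\Bbbk^n\to\Bbbk^s$ is a map $(x_1,\dots,x_n)\mapsto(x_{i_1},\dots,x_{i_s})$ with $i_1,\dots,i_s$ distinct. The map $\mu$ is recoverable at $x\in\mathcal{X}$ if the fiber $\mu^{-1}(\mu(x))\subseteq\mathcal X$ is finite; it is generically recoverable if it is recoverable at all $x\in\mathcal{X}\cap U$ for some nonempty Zariski open subset $U$ of $\overline{\mathcal{X}}$. *)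

theory Defs
  imports "HOL-Analysis.Analysis" "HOL-Library.Poly_Mapping"
begin

section \<open>Multivariate polynomials and zero loci\<close>

text \<open>Finitely supported families of coefficients indexed by exponent vectors; the ring
  structure is the convolution structure of \<^theory>\<open>HOL-Library.Poly_Mapping\<close>.\<close>

type_synonym ('v, 'a) mpoly = "('v \<Rightarrow>\<^sub>0 nat) \<Rightarrow>\<^sub>0 'a"

definition eval_monom :: "('v \<Rightarrow> 'a) \<Rightarrow> ('v \<Rightarrow>\<^sub>0 nat) \<Rightarrow> 'a::comm_semiring_1"
  where "eval_monom x m = (\<Prod>v\<in>Poly_Mapping.keys m. x v ^ Poly_Mapping.lookup m v)"

definition eval_mpoly :: "('v \<Rightarrow> 'a) \<Rightarrow> ('v, 'a) mpoly \<Rightarrow> 'a::comm_semiring_1"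
  where "eval_mpoly x p =
    (\<Sum>m\<in>Poly_Mapping.keys p. Poly_Mapping.lookup p m * eval_monom x m)"

lemma eval_monom_superset:
  assumes "finite V" "Poly_Mapping.keys m \<subseteq> V"
  shows "eval_monom x m = (\<Prod>v\<in>V. x v ^ Poly_Mapping.lookup m v)"
  unfolding eval_monom_def using assms
  by (intro prod.mono_neutral_left) (auto simp: in_keys_iff)

lemma eval_mpoly_superset:
  assumes "finite M" "Poly_Mapping.keys p \<subseteq> M"
  shows "eval_mpoly x p = (\<Sum>m\<in>M. Poly_Mapping.lookup p m * eval_monom x m)"
  unfolding eval_mpoly_def using assms
  by (intro sum.mono_neutral_left) (auto simp: in_keys_iff)

lemma eval_monom_zero [simp]: "eval_monom x 0 = 1"
  by (simp add: eval_monom_def)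

lemma eval_monom_add: "eval_monom x (a + b) = eval_monom x a * eval_monom x b"
proof -
  let ?V = "Poly_Mapping.keys a \<union> Poly_Mapping.keys b"
  have "Poly_Mapping.keys (a + b) \<subseteq> ?V" by (rule keys_add)
  then show ?thesis
    by (simp add: eval_monom_superset[of ?V] lookup_add power_add prod.distrib)
qed

lemma eval_mpoly_zero [simp]: "eval_mpoly x 0 = 0"
  by (simp add: eval_mpoly_def)

lemma eval_mpoly_single [simp]: "eval_mpoly x (Poly_Mapping.single m c) = c * eval_monom x m"
  by (cases "c = 0") (simp_all add: eval_mpoly_def)

lemma eval_mpoly_one [simp]: "eval_mpoly x 1 = 1"
  unfolding single_one[symmetric] eval_mpoly_single by simp

lemma eval_mpoly_add: "eval_mpoly x (p + q) = eval_mpoly x p + eval_mpoly x q"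
proof -
  let ?M = "Poly_Mapping.keys p \<union> Poly_Mapping.keys q"
  have "Poly_Mapping.keys (p + q) \<subseteq> ?M" by (rule keys_add)
  then show ?thesis
    by (simp add: eval_mpoly_superset[of ?M] lookup_add distrib_right sum.distrib)
qed

lemma eval_mpoly_mult: "eval_mpoly x (p * q) = eval_mpoly x p * eval_mpoly x q"
proof (induction p rule: update_induct)
  case const
  then show ?case by simp
next
  case (update f a b)
  have upd: "Poly_Mapping.update a b f = Poly_Mapping.single a b + f"
    using update.hyps
    by (intro poly_mapping_eqI) (auto simp: lookup_add lookup_update lookup_single in_keys_iff when_def)
  have single: "eval_mpoly x (Poly_Mapping.single a b * q) = b * eval_monom x a * eval_mpoly x q"
  proof (induction q rule: update_induct)
    case const
    then show ?case by simp
  next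
    case (update g c d)
    have "Poly_Mapping.update c d g = Poly_Mapping.single c d + g"
      using update.hyps
      by (intro poly_mapping_eqI) (auto simp: lookup_add lookup_update lookup_single in_keys_iff when_def)
    with update.IH show ?case
      by (simp add: distrib_left mult_single eval_mpoly_add eval_monom_add ac_simps)
  qed
  show ?case
    unfolding upd by (simp add: distrib_right eval_mpoly_add single update.IH)
qed

definition zero_locus :: "('n::finite, 'a) mpoly set \<Rightarrow> ('a::comm_semiring_1 ^ 'n) set"
  where "zero_locus F = {x. \<forall>f\<in>F. eval_mpoly (($) x) f = 0}"

section \<open>The Zariski topology and dimension\<close>

definition zariski :: "('a::field ^ 'n::finite) topology"
  where "zariski = topology (\<lambda>U. \<exists>F. U = - zero_locus F)"

lemma istopology_zariski:
  "istopology (\<lambda>U :: ('a::field ^ 'n::finite) set. \<exists>F. U = - zero_locus F)"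
  unfolding istopology_def
proof (intro conjI allI impI)
  fix S T :: "('a ^ 'n) set"
  assume "\<exists>F. S = - zero_locus F" "\<exists>F. T = - zero_locus F"
  then obtain F G where S: "S = - zero_locus F" and T: "T = - zero_locus G" by blast
  have "S \<inter> T = - zero_locus {f * g |f g. f \<in> F \<and> g \<in> G}"
    unfolding S T zero_locus_def by (auto simp: eval_mpoly_mult) (metis eval_mpoly_mult mult_eq_0_iff)
  then show "\<exists>F. S \<inter> T = - zero_locus F" by blast
next
  fix \<K> :: "('a ^ 'n) set set"
  assume "\<forall>K\<in>\<K>. \<exists>F. K = - zero_locus F"
  then obtain F where F: "\<And>K. K \<in> \<K> \<Longrightarrow> K = - zero_locus (F K)" by metis
  have "\<Union>\<K> = (\<Union>K\<in>\<K>. - zero_locus (F K))"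
    using F by auto
  also have "\<dots> = - zero_locus (\<Union>K\<in>\<K>. F K)"
    by (auto simp: zero_locus_def)
  finally have "\<Union>\<K> = - zero_locus (\<Union>K\<in>\<K>. F K)" .
  then show "\<exists>F. \<Union>\<K> = - zero_locus F" by blast
qed

lemma openin_zariski: "openin zariski U \<longleftrightarrow> (\<exists>F. U = - zero_locus F)"
  unfolding zariski_def by (simp add: topology_inverse'[OF istopology_zariski])

lemma topspace_zariski [simp]: "topspace zariski = UNIV"
proof -
  have "openin zariski (- zero_locus {1})"
    using openin_zariski by blast
  moreover have "- zero_locus {1} = UNIV"
    by (auto simp: zero_locus_def)
  ultimately show ?thesis
    using openin_subset by fastforce
qed

lemma closedin_zariski: "closedin zariski Z \<longleftrightarrow> (\<exists>F. Z = zero_locus F)"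
  by (auto simp: closedin_def openin_zariski Compl_eq_Diff_UNIV [symmetric])

definition irreducible_set :: "'b topology \<Rightarrow> 'b set \<Rightarrow> bool"
  where "irreducible_set T S \<longleftrightarrow> S \<noteq> {} \<and>
    (\<forall>A B. closedin (subtopology T S) A \<longrightarrow> closedin (subtopology T S) B \<longrightarrow> S = A \<union> B \<longrightarrow>
      A = S \<or> B = S)"

definition krull_dim :: "'b topology \<Rightarrow> enat"
  where "krull_dim T = Sup {enat m |m. \<exists>Z :: nat \<Rightarrow> 'b set.
    (\<forall>i\<le>m. closedin T (Z i) \<and> irreducible_set T (Z i)) \<and> (\<forall>i<m. Z i \<subset> Z (Suc i))}"

definition variety_dim :: "('a::field ^ 'n::finite) set \<Rightarrow> enat"
  where "variety_dim X = krull_dim (subtopology zariski (zariski closure_of X))"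

section \<open>Models and recoverability\<close>

definition implicit_model :: "('a::field ^ 'n::finite) set \<Rightarrow> bool"
  where "implicit_model X \<longleftrightarrow>
    (\<exists>F. finite F \<and> X = zero_locus F) \<and> irreducible_set zariski X"

text \<open>The number of parameters is the cardinality of the index type \<open>'l\<close>. The excluded
  case of no parameters (\<open>X\<close> a point) is covered by constant maps.\<close>

definition explicit_model :: "'l::finite itself \<Rightarrow> ('a::field ^ 'n::finite) set \<Rightarrow> bool"
  where "explicit_model _ X \<longleftrightarrow>
    (\<exists>\<phi> :: 'n \<Rightarrow> ('l, 'a) mpoly.
      X = range (\<lambda>t :: 'a ^ 'l. \<chi> i. eval_mpoly (($) t) (\<phi> i)))"

definition coordinate_projection :: "('a ^ 'n::finite \<Rightarrow> 'a ^ 's::finite) \<Rightarrow> bool"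
  where "coordinate_projection \<mu> \<longleftrightarrow> (\<exists>i :: 's \<Rightarrow> 'n. inj i \<and> \<mu> = (\<lambda>x. \<chi> j. x $ i j))"

text \<open>The map on the model is the restriction of \<open>\<mu>\<close>, so fibres are taken inside \<open>X\<close>.\<close>

definition recoverable_at :: "'b set \<Rightarrow> ('b \<Rightarrow> 'c) \<Rightarrow> 'b \<Rightarrow> bool"
  where "recoverable_at X \<mu> x \<longleftrightarrow> finite {y \<in> X. \<mu> y = \<mu> x}"

definition generically_recoverable :: "('a::field ^ 'n::finite) set \<Rightarrow> ('a ^ 'n \<Rightarrow> 'c) \<Rightarrow> bool"
  where "generically_recoverable X \<mu> \<longleftrightarrow>
    (\<exists>U. openin (subtopology zariski (zariski closure_of X)) U \<and> U \<noteq> {} \<and>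
      (\<forall>x \<in> X \<inter> U. recoverable_at X \<mu> x))"

end

theory Submission
  imports Defs "HOL-Computational_Algebra.Fundamental_Theorem_Algebra"
begin

text \<open>
  Write \<open>K\<close> for the field, \<open>Z\<close> for the model and call a coordinate \<open>v\<close> algebraic over a set \<open>S\<close> of
  coordinates if on \<open>Z\<close> it satisfies a polynomial equation with coefficients in \<open>K[S]\<close> whose leading
  coefficient does not vanish identically on \<open>Z\<close>. The theorem rests on three facts about an
  irreducible \<open>Z\<close>.

  \<^item> If all coordinates are algebraic over \<open>S\<close>, every chain of irreducible closed subsets has length
    at most \<open>card S\<close> (\<open>chain_length_le\<close>). Choosing for each step of the chain a function that
    vanishes on the smaller set only gives algebraically independent functions, while a count of
    monomials shows that more than \<open>card S\<close> functions are algebraically dependent.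
  \<^item> If \<open>B\<close> is an independent set of coordinates and \<open>Z\<close> is closed, there is a chain of length
    \<open>card B\<close> ending in \<open>Z\<close> (\<open>chain_of_independent\<close>). One slices \<open>Z\<close> by \<open>x\<^sub>b = c\<close>, where \<open>b\<close> is in \<open>B\<close>
    and \<open>c\<close> is the coordinate of a generic point, and finds in the slice an irreducible closed set
    on which \<open>B - {b}\<close> is still independent.
  \<^item> If \<open>b\<close> is not algebraic over \<open>S\<close> and \<open>Z\<close> is closed, then through generic points of \<open>Z\<close> the
    fibre of the projection to the coordinates in \<open>S\<close> is infinite (\<open>infinite_fibre\<close>).

  The last two facts need points with coordinates in \<open>K\<close>, which over \<open>\<real>\<close> cannot come from a
  Nullstellensatz. They come from lifting: \<open>Z\<close> is built up one coordinate at a time, and each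
  coordinate is either unconstrained by the previous ones or, generically, a simple root of its
  polynomial of minimal degree; simple roots move only slightly under small perturbations
  of the coefficients, over \<open>\<real>\<close> by the intermediate value theorem and over \<open>\<complex>\<close> by factorization.
  Hence all points near the projection of a generic point that satisfy the constraints on the projected
  coordinates lift to \<open>Z\<close> (\<open>lift_point\<close>).

  If a coordinate projection to the coordinates in \<open>S\<close> is generically recoverable, the third fact makes
  all coordinates algebraic over \<open>S\<close>, and the first one bounds the dimension by \<open>card S\<close>. Conversely, a
  maximal independent set \<open>B\<close> of coordinates has at most \<open>s\<close> elements by the second fact, all
  coordinates are algebraic over it, and projecting to any \<open>s\<close> coordinates containing \<open>B\<close> has finite
  fibres wherever the relations do not degenerate. An explicit model need not be closed; it is
  handled as the projection of the graph of its parametrization, which is closed and irreducible.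
\<close>

section \<open>Polynomial functions\<close>

text \<open>Polynomials are treated as functions, and \<open>T\<close> is the set of coordinates that may occur. Since
  \<open>T\<close> is a set and not a type, coordinates can be adjoined one at a time by induction.\<close>
inductive_set poly_funs :: "'v set \<Rightarrow> (('v \<Rightarrow> 'a::comm_ring_1) \<Rightarrow> 'a) set" for T where
  const: "(\<lambda>x. c) \<in> poly_funs T"
| var: "v \<in> T \<Longrightarrow> (\<lambda>x. x v) \<in> poly_funs T"
| add: "f \<in> poly_funs T \<Longrightarrow> g \<in> poly_funs T \<Longrightarrow> (\<lambda>x. f x + g x) \<in> poly_funs T"
| mult: "f \<in> poly_funs T \<Longrightarrow> g \<in> poly_funs T \<Longrightarrow> (\<lambda>x. f x * g x) \<in> poly_funs T"

lemma poly_funs_mono: "S \<subseteq> T \<Longrightarrow> f \<in> poly_funs S \<Longrightarrow> f \<in> poly_funs T"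
  by (rotate_tac, induction rule: poly_funs.induct) (auto intro: poly_funs.intros)

lemma poly_funs_power: "f \<in> poly_funs T \<Longrightarrow> (\<lambda>x. f x ^ n) \<in> poly_funs T"
  by (induction n) (auto intro: poly_funs.intros)

lemma poly_funs_sum:
  "(\<And>i. i \<in> I \<Longrightarrow> f i \<in> poly_funs T) \<Longrightarrow> (\<lambda>x. \<Sum>i\<in>I. f i x) \<in> poly_funs T"
  by (induction I rule: infinite_finite_induct) (auto intro: poly_funs.intros)

lemma poly_funs_prod:
  "(\<And>i. i \<in> I \<Longrightarrow> f i \<in> poly_funs T) \<Longrightarrow> (\<lambda>x. \<Prod>i\<in>I. f i x) \<in> poly_funs T"
  by (induction I rule: infinite_finite_induct) (auto intro: poly_funs.intros)

lemma poly_funs_uminus: "f \<in> poly_funs T \<Longrightarrow> (\<lambda>x. - f x) \<in> poly_funs T"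
  using mult[OF const[of "-1"], of f T] by simp

lemma poly_funs_diff:
  "f \<in> poly_funs T \<Longrightarrow> g \<in> poly_funs T \<Longrightarrow> (\<lambda>x. f x - g x) \<in> poly_funs T"
  using add[of f T "\<lambda>x. - g x"] poly_funs_uminus by auto

lemmas poly_funs_intros = poly_funs.intros poly_funs_power poly_funs_sum poly_funs_prod
  poly_funs_uminus poly_funs_diff

lemma poly_funs_cong:
  "f \<in> poly_funs T \<Longrightarrow> (\<And>v. v \<in> T \<Longrightarrow> x v = y v) \<Longrightarrow> f x = f y"
  by (induction rule: poly_funs.induct) auto

lemma poly_funs_subst:
  "f \<in> poly_funs T \<Longrightarrow> (\<And>v. v \<in> T \<Longrightarrow> h v \<in> poly_funs U) \<Longrightarrow>
    (\<lambda>x. f (\<lambda>v. h v x)) \<in> poly_funs U"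
  by (induction rule: poly_funs.induct) (auto intro: poly_funs.intros)

text \<open>These are the polynomials in \<open>x v\<close> of degree less than \<open>n\<close> with coefficients in \<open>poly_funs T\<close>. The
  strict bound makes induction on \<open>n\<close> start at the zero polynomial.\<close>
definition poly_in :: "'v set \<Rightarrow> 'v \<Rightarrow> nat \<Rightarrow> (('v \<Rightarrow> 'a::comm_ring_1) \<Rightarrow> 'a) set" where
  "poly_in T v n = {f. \<exists>c. (\<forall>i. c i \<in> poly_funs T) \<and> f = (\<lambda>x. \<Sum>i<n. c i x * x v ^ i)}"

lemma poly_inI:
  "(\<And>i. c i \<in> poly_funs T) \<Longrightarrow> (\<lambda>x. \<Sum>i<n. c i x * x v ^ i) \<in> poly_in T v n"
  unfolding poly_in_def mem_Collect_eq by (rule exI[of _ c]) simp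

lemma poly_inE:
  assumes "f \<in> poly_in T v n"
  obtains c where "\<And>i. c i \<in> poly_funs T" "f = (\<lambda>x. \<Sum>i<n. c i x * x v ^ i)"
  using assms unfolding poly_in_def by blast

lemma poly_in_SucE:
  assumes "f \<in> poly_in T v (Suc n)"
  obtains c g where "c \<in> poly_funs T" "g \<in> poly_in T v n" "f = (\<lambda>x. c x + x v * g x)"
proof -
  obtain c where c: "\<And>i. c i \<in> poly_funs T" "f = (\<lambda>x. \<Sum>i<Suc n. c i x * x v ^ i)"
    using assms by (rule poly_inE) blast
  have "f = (\<lambda>x. c 0 x + x v * (\<Sum>i<n. c (Suc i) x * x v ^ i))"
    unfolding c(2) by (simp only: sum.lessThan_Suc_shift) (simp add: sum_distrib_left mult_ac)
  with c(1) poly_inI[of "\<lambda>i. c (Suc i)"] that show ?thesis by blast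
qed

lemma poly_in_SucI:
  assumes "a \<in> poly_funs T" "g \<in> poly_in T v n"
  shows "(\<lambda>x. a x + x v * g x) \<in> poly_in T v (Suc n)"
proof -
  obtain c where c: "\<And>i. c i \<in> poly_funs T" "g = (\<lambda>x. \<Sum>i<n. c i x * x v ^ i)"
    using assms(2) by (rule poly_inE) blast
  have "(\<lambda>x. a x + x v * g x) = (\<lambda>x. \<Sum>i<Suc n. case_nat a c i x * x v ^ i)"
    unfolding c(2) by (simp only: sum.lessThan_Suc_shift) (simp add: sum_distrib_left mult_ac)
  moreover have "case_nat a c i \<in> poly_funs T" for i
    using c(1) assms(1) by (cases i) auto
  ultimately show ?thesis
    by (simp only: poly_inI)
qed

lemma poly_in_0 [simp]: "poly_in T v 0 = {\<lambda>x. 0}"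
  by (auto simp: poly_in_def intro!: exI[of _ "\<lambda>_ _. 0"] poly_funs.const)

lemma poly_in_zero: "(\<lambda>x. 0) \<in> poly_in T v n"
  by (auto simp: poly_in_def intro!: exI[of _ "\<lambda>_ _. 0"] poly_funs.const)

lemma poly_in_mono: "m \<le> n \<Longrightarrow> f \<in> poly_in T v m \<Longrightarrow> f \<in> poly_in T v n"
proof (induction m arbitrary: n f)
  case 0
  then show ?case by (simp add: poly_in_zero)
next
  case (Suc m)
  then obtain n' where "n = Suc n'" "m \<le> n'" by (cases n) auto
  moreover obtain c g where "c \<in> poly_funs T" "g \<in> poly_in T v m" "f = (\<lambda>x. c x + x v * g x)"
    using Suc.prems by (elim poly_in_SucE) blast
  ultimately show ?case
    using Suc.IH[of n' g] poly_in_SucI by simp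
qed

lemma poly_in_add:
  assumes "f \<in> poly_in T v n" "g \<in> poly_in T v n"
  shows "(\<lambda>x. f x + g x) \<in> poly_in T v n"
proof -
  obtain c d where "\<And>i. c i \<in> poly_funs T" "f = (\<lambda>x. \<Sum>i<n. c i x * x v ^ i)"
    "\<And>i. d i \<in> poly_funs T" "g = (\<lambda>x. \<Sum>i<n. d i x * x v ^ i)"
    using assms by (elim poly_inE) blast
  then show ?thesis
    using poly_inI[of "\<lambda>i x. c i x + d i x" T v n]
    by (simp add: poly_funs.add sum.distrib distrib_right)
qed

lemma poly_in_smult:
  assumes "f \<in> poly_in T v n" "g \<in> poly_funs T"
  shows "(\<lambda>x. g x * f x) \<in> poly_in T v n"
proof -
  obtain c where "\<And>i. c i \<in> poly_funs T" "f = (\<lambda>x. \<Sum>i<n. c i x * x v ^ i)"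
    using assms by (elim poly_inE) blast
  with assms(2) show ?thesis
    using poly_inI[of "\<lambda>i x. g x * c i x" T v n]
    by (simp add: poly_funs.mult sum_distrib_left mult_ac)
qed

lemma poly_in_mult:
  "f \<in> poly_in T v m \<Longrightarrow> g \<in> poly_in T v n \<Longrightarrow> (\<lambda>x. f x * g x) \<in> poly_in T v (m + n)"
proof (induction m arbitrary: f)
  case 0
  then show ?case by (simp add: poly_in_zero)
next
  case (Suc m)
  then obtain c f' where f': "c \<in> poly_funs T" "f' \<in> poly_in T v m"
    "f = (\<lambda>x. c x + x v * f' x)"
    by (elim poly_in_SucE) blast
  have "(\<lambda>x. f' x * g x) \<in> poly_in T v (m + n)"
    using Suc f' by blast
  then have "(\<lambda>x. 0 + x v * (f' x * g x)) \<in> poly_in T v (Suc m + n)"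
    unfolding add_Suc by (intro poly_in_SucI poly_funs.const)
  moreover have "(\<lambda>x. c x * g x) \<in> poly_in T v (Suc m + n)"
    using Suc.prems f' by (intro poly_in_mono[OF _ poly_in_smult]) auto
  ultimately have "(\<lambda>x. c x * g x + (0 + x v * (f' x * g x))) \<in> poly_in T v (Suc m + n)"
    by (rule poly_in_add[rotated])
  then show ?case
    unfolding f'(3) by (simp add: algebra_simps)
qed

lemma poly_funs_insert_expand:
  assumes "f \<in> poly_funs (insert v T)"
  shows "\<exists>n. f \<in> poly_in T v n"
  using assms
proof (induction rule: poly_funs.induct)
  case (const c)
  have "(\<lambda>x. c) \<in> poly_in T v (Suc 0)"
    using poly_in_SucI[of "\<lambda>_. c" T "\<lambda>_. 0" v 0] by (simp add: poly_funs.const)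
  then show ?case by blast
next
  case (var u)
  show ?case
  proof (cases "u = v")
    case True
    have "(\<lambda>x. 1) \<in> poly_in T v (Suc 0)"
      using poly_in_SucI[of "\<lambda>_. 1" T "\<lambda>_. 0" v 0] by (simp add: poly_funs.const)
    then have "(\<lambda>x. 0 + x v * 1) \<in> poly_in T v (Suc (Suc 0))"
      by (intro poly_in_SucI poly_funs.const)
    with True show ?thesis by auto
  next
    case False
    with var have "(\<lambda>x. x u) \<in> poly_in T v (Suc 0)"
      using poly_in_SucI[of "\<lambda>x. x u" T "\<lambda>_. 0" v 0] by (simp add: poly_funs.var)
    then show ?thesis by blast
  qed
next
  case (add f g)
  then obtain m n where "f \<in> poly_in T v m" "g \<in> poly_in T v n" by auto
  then have "(\<lambda>x. f x + g x) \<in> poly_in T v (max m n)"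
    by (intro poly_in_add) (auto intro: poly_in_mono[rotated])
  then show ?case by blast
next
  case (mult f g)
  then obtain m n where "f \<in> poly_in T v m" "g \<in> poly_in T v n" by auto
  then show ?case by (intro exI[of _ "m + n"] poly_in_mult)
qed

text \<open>Division by a polynomial of degree \<open>e\<close> whose leading coefficient is not invertible. Only the zeros
  of the divisor matter later, so the quotient need not be recorded.\<close>
lemma pseudo_division:
  assumes h: "\<And>i. c i \<in> poly_funs T"
    and f: "f \<in> poly_in T v n"
  shows "\<exists>k. \<exists>r\<in>poly_in T v e. \<forall>x. (\<Sum>i\<le>e. c i x * x v ^ i) = 0 \<longrightarrow> c e x ^ k * f x = r x"
  using f
proof (induction n arbitrary: f)
  case 0
  then show ?case by (auto intro!: exI[of _ 0] bexI[OF _ poly_in_zero])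
next
  case (Suc n)
  show ?case
  proof (cases "Suc n \<le> e")
    case True
    have "f \<in> poly_in T v e" by (rule poly_in_mono[OF True Suc.prems])
    then show ?thesis by (intro exI[of _ 0] bexI[of _ f]) auto
  next
    case False
    obtain a where a: "\<And>i. a i \<in> poly_funs T" "f = (\<lambda>x. \<Sum>i<Suc n. a i x * x v ^ i)"
      using Suc.prems by (elim poly_inE) blast
    \<comment> \<open>the coefficients of that multiple of the divisor which cancels the leading term of \<open>f\<close>\<close>
    define b where "b i x = (if i < n - e then 0 else a n x * c (i - (n - e)) x)" for i x
    have b: "b i \<in> poly_funs T" for i
      using a(1) h unfolding b_def by (cases "i < n - e") (simp_all add: poly_funs_intros)
    define g where "g x = (\<Sum>i<n. (c e x * a i x - b i x) * x v ^ i)" for x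
    have "(\<Sum>i<Suc n. b i x * x v ^ i) = a n x * x v ^ (n - e) * (\<Sum>i\<le>e. c i x * x v ^ i)" for x
    proof -
      have "(\<Sum>i<Suc n. b i x * x v ^ i) = (\<Sum>i\<in>{n-e..<Suc n}. b i x * x v ^ i)"
        by (rule sum.mono_neutral_right) (auto simp: b_def)
      also have "\<dots> = (\<Sum>i\<le>e. b (i + (n - e)) x * x v ^ (i + (n - e)))"
        using False by (intro sum.reindex_bij_witness[of _ "\<lambda>i. i + (n - e)" "\<lambda>i. i - (n - e)"]) auto
      also have "\<dots> = a n x * x v ^ (n - e) * (\<Sum>i\<le>e. c i x * x v ^ i)"
        by (simp add: b_def sum_distrib_left power_add mult_ac)
      finally show ?thesis .
    qed
    then have b0: "(\<Sum>i<Suc n. b i x * x v ^ i) = 0" if "(\<Sum>i\<le>e. c i x * x v ^ i) = 0" for x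
      using that by simp
    have bn: "b n x = a n x * c e x" for x
      using False by (simp add: b_def)
    have fg: "c e x * f x = g x" if "(\<Sum>i\<le>e. c i x * x v ^ i) = 0" for x
    proof -
      have "c e x * f x = (\<Sum>i<Suc n. (c e x * a i x - b i x) * x v ^ i)"
        unfolding left_diff_distrib sum_subtractf b0[OF that] a(2)
        by (simp only: sum_distrib_left mult_ac diff_zero)
      then show ?thesis by (simp add: g_def bn mult.commute)
    qed
    have "g \<in> poly_in T v n"
      unfolding g_def by (intro poly_inI poly_funs_intros a b h)
    then obtain k r where r: "r \<in> poly_in T v e"
      "\<forall>x. (\<Sum>i\<le>e. c i x * x v ^ i) = 0 \<longrightarrow> c e x ^ k * g x = r x"
      using Suc.IH by blast
    have "\<forall>x. (\<Sum>i\<le>e. c i x * x v ^ i) = 0 \<longrightarrow> c e x ^ Suc k * f x = r x"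
    proof (intro allI impI)
      fix x assume x: "(\<Sum>i\<le>e. c i x * x v ^ i) = 0"
      have "c e x ^ Suc k * f x = c e x ^ k * (c e x * f x)"
        by (simp add: mult_ac)
      with x r(2) show "c e x ^ Suc k * f x = r x" by (simp only: fg)
    qed
    then show ?thesis by (intro exI bexI) (assumption, rule r(1))
  qed
qed

text \<open>A polynomial whose top coefficients vanish on \<open>Z\<close> has a smaller effective degree there. Every
  minimality argument below compares this effective degree with a minimal one.\<close>
lemma leading_term:
  fixes d :: "nat \<Rightarrow> 'x \<Rightarrow> 'a::comm_ring_1"
  assumes "\<exists>i<n. \<exists>x\<in>Z. d i x \<noteq> 0"
  obtains e where "e < n" "\<exists>x\<in>Z. d e x \<noteq> 0"
    "\<And>x t. x \<in> Z \<Longrightarrow> (\<Sum>i<n. d i x * t ^ i) = (\<Sum>i\<le>e. d i x * t ^ i)"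
proof -
  define P where "P i \<longleftrightarrow> i < n \<and> (\<exists>x\<in>Z. d i x \<noteq> 0)" for i
  define e where "e = Greatest P"
  have bound: "i \<le> n" if "P i" for i using that by (simp add: P_def)
  have "\<exists>i. P i" using assms by (simp add: P_def)
  then have "P e" unfolding e_def by (rule GreatestI_ex_nat) (rule bound)
  then have 1: "e < n" "\<exists>x\<in>Z. d e x \<noteq> 0" by (simp_all add: P_def)
  have 2: "d i x = 0" if "i < n" "x \<in> Z" "e < i" for i x
  proof (rule ccontr)
    assume "d i x \<noteq> 0"
    then have "P i" using that by (auto simp: P_def)
    then have "i \<le> e" unfolding e_def by (rule Greatest_le_nat) (rule bound)
    with that show False by simp
  qed
  have "(\<Sum>i<n. d i x * t ^ i) = (\<Sum>i\<le>e. d i x * t ^ i)" if "x \<in> Z" for x t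
    using 1(1) 2 that by (intro sum.mono_neutral_right) auto
  with that 1 show thesis by blast
qed

text \<open>Restriction to lines reduces statements about polynomial functions to the finiteness of the roots
  of a univariate polynomial.\<close>
lemma poly_funs_line:
  assumes "f \<in> poly_funs T"
  shows "\<exists>p. \<forall>s. f (\<lambda>v. a v + s * b v) = poly p s"
  using assms
proof (induction rule: poly_funs.induct)
  case (const c)
  show ?case by (rule exI[of _ "[:c:]"]) simp
next
  case (var v)
  show ?case by (rule exI[of _ "[:a v, b v:]"]) (simp add: mult.commute)
next
  case (add f g)
  then show ?case by (metis poly_add)
next
  case (mult f g)
  then show ?case by (metis poly_mult)
qed

lemma poly_funs_no_zero_divisors:
  fixes f g :: "('v \<Rightarrow> 'a::{idom,ring_char_0}) \<Rightarrow> 'a"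
  assumes "f \<in> poly_funs T" "g \<in> poly_funs T" "\<And>x. f x * g x = 0"
  shows "(\<forall>x. f x = 0) \<or> (\<forall>x. g x = 0)"
proof (rule ccontr)
  assume "\<not> ?thesis"
  then obtain x y where xy: "f x \<noteq> 0" "g y \<noteq> 0" by blast
  obtain p q where p: "\<And>s. f (\<lambda>v. x v + s * (y v - x v)) = poly p s"
    and q: "\<And>s. g (\<lambda>v. x v + s * (y v - x v)) = poly q s"
    using poly_funs_line[OF assms(1)] poly_funs_line[OF assms(2)] by meson
  have "poly p 0 \<noteq> 0" "poly q 1 \<noteq> 0"
    unfolding p[symmetric] q[symmetric] using xy by simp_all
  then have "p * q \<noteq> 0" by auto
  moreover have "poly (p * q) s = 0" for s
    using assms(3) by (simp flip: p q)
  ultimately show False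
    using poly_all_0_iff_0 by blast
qed

section \<open>Nearby points and the stability of simple roots\<close>
text \<open>The neighbourhood filter of \<open>y\<close> with respect to the coordinates in \<open>T\<close> only.\<close>
definition near :: "'v set \<Rightarrow> ('v \<Rightarrow> 'a::metric_space) \<Rightarrow> ('v \<Rightarrow> 'a) filter" where
  "near T y = (INF d\<in>{0<..}. principal {x. \<forall>v\<in>T. dist (x v) (y v) < d})"

lemma eventually_near:
  "eventually P (near T y) \<longleftrightarrow> (\<exists>d>0. \<forall>x. (\<forall>v\<in>T. dist (x v) (y v) < d) \<longrightarrow> P x)"
proof -
  have "eventually P (near T y) \<longleftrightarrow>
      (\<exists>d\<in>{0<..}. eventually P (principal {x. \<forall>v\<in>T. dist (x v) (y v) < d}))"
    unfolding near_def
  proof (rule eventually_INF_base)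
    fix a b :: real assume "a \<in> {0<..}" "b \<in> {0<..}"
    then show "\<exists>c\<in>{0<..}. principal {x. \<forall>v\<in>T. dist (x v) (y v) < c} \<le>
        inf (principal {x. \<forall>v\<in>T. dist (x v) (y v) < a}) (principal {x. \<forall>v\<in>T. dist (x v) (y v) < b})"
      by (intro bexI[of _ "min a b"]) auto
  qed auto
  then show ?thesis by (auto simp: eventually_principal)
qed

lemma tendsto_near:
  fixes f :: "('v \<Rightarrow> 'a::real_normed_field) \<Rightarrow> 'a"
  shows "f \<in> poly_funs T \<Longrightarrow> (f \<longlongrightarrow> f y) (near T y)"
proof (induction rule: poly_funs.induct)
  case (var v)
  then show ?case unfolding tendsto_iff eventually_near by blast
qed (auto intro!: tendsto_intros)

lemma poly_funs_eq_0_if_near: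
  fixes f :: "('v \<Rightarrow> 'a::real_normed_field) \<Rightarrow> 'a"
  assumes f: "f \<in> poly_funs T" and "finite T" and ev: "eventually (\<lambda>x. f x = 0) (near T y)"
  shows "f x = 0"
proof -
  obtain d where d: "d > 0" "\<And>x. (\<forall>v\<in>T. dist (x v) (y v) < d) \<Longrightarrow> f x = 0"
    using ev by (auto simp: eventually_near)
  obtain p where p: "\<And>s. f (\<lambda>v. y v + s * (x v - y v)) = poly p s"
    using poly_funs_line[OF f] by meson
  \<comment> \<open>the segment from \<open>y\<close> to \<open>x\<close> stays in the box of radius \<open>d\<close> for parameters below \<open>d / B\<close>\<close>
  define B where "B = 1 + (\<Sum>v\<in>T. norm (x v - y v))"
  have B: "B > 0"
    unfolding B_def by (intro add_pos_nonneg sum_nonneg) auto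
  have B2: "v \<in> T \<Longrightarrow> norm (x v - y v) < B" for v
    unfolding B_def using \<open>finite T\<close> member_le_sum[of v T "\<lambda>v. norm (x v - y v)"] by force
  have zero: "poly p (of_real s) = 0" if "s \<in> {0<..<d / B}" for s
    unfolding p[symmetric]
  proof (rule d(2), rule ballI)
    fix v assume "v \<in> T"
    then have "s * norm (x v - y v) \<le> s * B"
      using that B2[of v] by (intro mult_left_mono) auto
    also have "s * B < d" using that B by (simp add: pos_less_divide_eq)
    finally show "dist (y v + of_real s * (x v - y v)) (y v) < d"
      using that by (simp add: dist_norm norm_mult)
  qed
  have "infinite ((of_real :: real \<Rightarrow> 'a) ` {0<..<d / B})"
    using d(1) B by (subst finite_image_iff) (auto simp: inj_on_def infinite_Ioo)
  moreover have "(of_real :: real \<Rightarrow> 'a) ` {0<..<d / B} \<subseteq> {s. poly p s = 0}"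
    using zero by auto
  ultimately have "p = 0"
    using poly_roots_finite finite_subset by blast
  with p[of 1] show ?thesis by simp
qed

lemma poly_perturb:
  fixes p :: "'a::real_normed_field poly"
  assumes "\<epsilon> > 0"
  shows "\<exists>\<delta>>0. \<forall>q. degree q \<le> degree p \<longrightarrow> (\<forall>i. norm (coeff q i - coeff p i) < \<delta>) \<longrightarrow>
    norm (poly q t - poly p t) < \<epsilon>"
proof -
  define B where "B = 1 + (\<Sum>i\<le>degree p. norm t ^ i)"
  have B: "B > 0" unfolding B_def by (intro add_pos_nonneg sum_nonneg) auto
  have "norm (poly q t - poly p t) < \<epsilon>"
    if q: "degree q \<le> degree p" "\<forall>i. norm (coeff q i - coeff p i) < \<epsilon> / B" for q
  proof -
    have "poly q t = (\<Sum>i\<le>degree p. coeff q i * t ^ i)"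
      unfolding poly_altdef using q(1)
      by (intro sum.mono_neutral_left) (auto simp: coeff_eq_0)
    then have "norm (poly q t - poly p t) = norm (\<Sum>i\<le>degree p. (coeff q i - coeff p i) * t ^ i)"
      by (simp add: poly_altdef[of p] sum_subtractf left_diff_distrib)
    also have "\<dots> \<le> (\<Sum>i\<le>degree p. \<epsilon> / B * norm t ^ i)"
      using q(2) by (intro sum_norm_le) (simp add: norm_mult norm_power less_imp_le mult_right_mono del: times_divide_eq_left)
    also have "\<dots> = \<epsilon> / B * (B - 1)"
      unfolding B_def sum_distrib_left[symmetric] by simp
    also have "\<dots> < \<epsilon>" using assms B by (simp add: field_simps)
    finally show ?thesis .
  qed
  then show ?thesis using assms B by (intro exI[of _ "\<epsilon> / B"]) auto
qed

text \<open>Besides being normed fields, \<open>\<real>\<close> and \<open>\<complex>\<close> need to share only this for the argument: a simple root of a polynomial of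
  degree \<open>n\<close> persists nearby when the coefficients are perturbed. Sums replace the polynomial type
  because the coefficients will be values of polynomial functions at varying points.\<close>
class stable_root_field = real_normed_field +
  assumes stable_root: "(\<Sum>i\<le>n. c i * x ^ i) = 0 \<Longrightarrow> (\<Sum>i\<le>n. of_nat i * c i * x ^ (i - 1)) \<noteq> 0 \<Longrightarrow>
    c n \<noteq> 0 \<Longrightarrow> \<epsilon> > 0 \<Longrightarrow> \<exists>\<delta>>0. \<forall>d. (\<forall>i\<le>n. norm (d i - c i) < \<delta>) \<longrightarrow>
      (\<exists>z. (\<Sum>i\<le>n. d i * z ^ i) = 0 \<and> norm (z - x) < \<epsilon>)"


lemma stable_root_from_poly:
  fixes c :: "nat \<Rightarrow> 'a::real_normed_field"
  assumes *: "\<And>p. degree p = n \<Longrightarrow> p \<noteq> 0 \<Longrightarrow> poly p x = 0 \<Longrightarrow> poly (pderiv p) x \<noteq> 0 \<Longrightarrow>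
    \<exists>\<delta>>0. \<forall>q. degree q \<le> degree p \<longrightarrow> (\<forall>i. norm (coeff q i - coeff p i) < \<delta>) \<longrightarrow>
      (\<exists>z. poly q z = 0 \<and> norm (z - x) < \<epsilon>)"
  and c: "(\<Sum>i\<le>n. c i * x ^ i) = 0" "(\<Sum>i\<le>n. of_nat i * c i * x ^ (i - 1)) \<noteq> 0" "c n \<noteq> 0"
  shows "\<exists>\<delta>>0. \<forall>d. (\<forall>i\<le>n. norm (d i - c i) < \<delta>) \<longrightarrow>
      (\<exists>z. (\<Sum>i\<le>n. d i * z ^ i) = 0 \<and> norm (z - x) < \<epsilon>)"
proof -
  define P where "P d = (\<Sum>i\<le>n. monom (d i) i)" for d :: "nat \<Rightarrow> 'a"
  have coeff: "coeff (P d) i = (if i \<le> n then d i else 0)" for d i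
    by (simp add: P_def coeff_sum)
  have deg: "degree (P d) \<le> n" for d
    by (rule degree_le) (simp add: coeff)
  then have "degree (P c) = n"
    using c(3) by (intro antisym le_degree) (auto simp: coeff)
  moreover from this have "P c \<noteq> 0" using c(3) coeff[of c n] by auto
  moreover have poly: "poly (P d) z = (\<Sum>i\<le>n. d i * z ^ i)" for d z
    by (simp add: P_def poly_sum poly_monom)
  moreover have "poly (pderiv (P c)) x = (\<Sum>i\<le>n. of_nat i * c i * x ^ (i - 1))"
    by (simp add: P_def higher_pderiv_sum[of 1, simplified] pderiv_monom poly_sum poly_monom)
  ultimately obtain \<delta> where d: "\<delta> > 0" "\<And>q. degree q \<le> n \<Longrightarrow> \<forall>i. norm (coeff q i - coeff (P c) i) < \<delta> \<Longrightarrow>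
      \<exists>z. poly q z = 0 \<and> norm (z - x) < \<epsilon>"
    using *[of "P c"] c by auto
  have "\<exists>z. (\<Sum>i\<le>n. d i * z ^ i) = 0 \<and> norm (z - x) < \<epsilon>" if "\<forall>i\<le>n. norm (d i - c i) < \<delta>" for d
    using d(2)[OF deg[of d]] d(1) that by (simp add: coeff poly)
  with d(1) show ?thesis by blast
qed

text \<open>Close to a simple root the polynomial takes values of both signs. These signs survive a small
  perturbation, and the intermediate value theorem yields a root in between.\<close>
lemma stable_root_real:
  fixes p :: "real poly"
  assumes x: "poly p x = 0" "poly (pderiv p) x \<noteq> 0" "\<epsilon> > 0"
  shows "\<exists>\<delta>>0. \<forall>q. degree q \<le> degree p \<longrightarrow> (\<forall>i. norm (coeff q i - coeff p i) < \<delta>) \<longrightarrow>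
      (\<exists>z. poly q z = 0 \<and> norm (z - x) < \<epsilon>)"
proof -
  have D: "(poly p has_real_derivative poly (pderiv p) x) (at x)" by (rule poly_DERIV)
  have "\<exists>a b. x - \<epsilon> < a \<and> a < x \<and> x < b \<and> b < x + \<epsilon> \<and> poly p a * poly p b < 0"
  proof (cases "poly (pderiv p) x > 0")
    case True
    obtain d1 where d1: "d1 > 0" "\<And>h. h > 0 \<Longrightarrow> h < d1 \<Longrightarrow> poly p x < poly p (x + h)"
      using DERIV_pos_inc_right[OF D True] by blast
    obtain d2 where d2: "d2 > 0" "\<And>h. h > 0 \<Longrightarrow> h < d2 \<Longrightarrow> poly p (x - h) < poly p x"
      using DERIV_pos_inc_left[OF D True] by blast
    define h where "h = min \<epsilon> (min d1 d2) / 2"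
    have "h > 0" "h < d1" "h < d2" "h < \<epsilon>" using d1 d2 x by (auto simp: h_def)
    then show ?thesis using d1(2)[of h] d2(2)[of h] x(1)
      by (intro exI[of _ "x - h"] exI[of _ "x + h"]) (auto simp: mult_less_0_iff)
  next
    case False
    with x have F: "poly (pderiv p) x < 0" by simp
    obtain d1 where d1: "d1 > 0" "\<And>h. h > 0 \<Longrightarrow> h < d1 \<Longrightarrow> poly p x > poly p (x + h)"
      using DERIV_neg_dec_right[OF D F] by blast
    obtain d2 where d2: "d2 > 0" "\<And>h. h > 0 \<Longrightarrow> h < d2 \<Longrightarrow> poly p (x - h) > poly p x"
      using DERIV_neg_dec_left[OF D F] by blast
    define h where "h = min \<epsilon> (min d1 d2) / 2"
    have "h > 0" "h < d1" "h < d2" "h < \<epsilon>" using d1 d2 x by (auto simp: h_def)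
    then show ?thesis using d1(2)[of h] d2(2)[of h] x(1)
      by (intro exI[of _ "x - h"] exI[of _ "x + h"]) (auto simp: mult_less_0_iff)
  qed
  then obtain a b where ab: "x - \<epsilon> < a" "a < x" "x < b" "b < x + \<epsilon>" "poly p a * poly p b < 0"
    by blast
  obtain \<delta>1 where d1: "\<delta>1 > 0" "\<And>q. degree q \<le> degree p \<Longrightarrow> \<forall>i. norm (coeff q i - coeff p i) < \<delta>1 \<Longrightarrow>
      norm (poly q a - poly p a) < \<bar>poly p a\<bar>"
    using poly_perturb[of "\<bar>poly p a\<bar>" p a] ab(5) by (cases "poly p a = 0") auto
  obtain \<delta>2 where d2: "\<delta>2 > 0" "\<And>q. degree q \<le> degree p \<Longrightarrow> \<forall>i. norm (coeff q i - coeff p i) < \<delta>2 \<Longrightarrow>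
      norm (poly q b - poly p b) < \<bar>poly p b\<bar>"
    using poly_perturb[of "\<bar>poly p b\<bar>" p b] ab(5) by (cases "poly p b = 0") auto
  have "\<exists>z. poly q z = 0 \<and> norm (z - x) < \<epsilon>"
    if q: "degree q \<le> degree p" "\<forall>i. norm (coeff q i - coeff p i) < min \<delta>1 \<delta>2" for q
  proof -
    have "\<bar>poly q a - poly p a\<bar> < \<bar>poly p a\<bar>" "\<bar>poly q b - poly p b\<bar> < \<bar>poly p b\<bar>"
      using d1(2)[of q] d2(2)[of q] q by auto
    then have "poly q a * poly q b < 0"
      using ab(5) by (auto simp: mult_less_0_iff)
    then obtain z where "z > a" "z < b" "poly q z = 0"
      using poly_IVT[of a b q] ab by auto
    with ab show ?thesis by (intro exI[of _ z]) auto
  qed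
  then show "\<exists>\<delta>>0. \<forall>q. degree q \<le> degree p \<longrightarrow> (\<forall>i. norm (coeff q i - coeff p i) < \<delta>) \<longrightarrow>
      (\<exists>z. poly q z = 0 \<and> norm (z - x) < \<epsilon>)"
    using d1(1) d2(1) by (intro exI[of _ "min \<delta>1 \<delta>2"]) auto
qed

text \<open>The value at \<open>x\<close> of a perturbed polynomial \<open>q\<close> is its leading coefficient times the product of the
  differences between \<open>x\<close> and the roots of \<open>q\<close>. The value is small and the leading coefficient is bounded
  away from zero, so some root is close to \<open>x\<close>.\<close>
lemma stable_root_complex:
  fixes p :: "complex poly"
  assumes x: "p \<noteq> 0" "poly p x = 0" "\<epsilon> > 0"
  shows "\<exists>\<delta>>0. \<forall>q. degree q \<le> degree p \<longrightarrow> (\<forall>i. norm (coeff q i - coeff p i) < \<delta>) \<longrightarrow>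
      (\<exists>z. poly q z = 0 \<and> norm (z - x) < \<epsilon>)"
proof -
  define L where "L = norm (lead_coeff p)"
  have L: "L > 0" using x by (auto simp: L_def)
  \<comment> \<open>below this value of \<open>norm (poly q x)\<close> not all roots of \<open>q\<close> can be \<open>\<epsilon>\<close>-far from \<open>x\<close>\<close>
  define \<eta> where "\<eta> = L / 2 * \<epsilon> ^ degree p"
  have \<eta>: "\<eta> > 0" using L x by (simp add: \<eta>_def)
  obtain \<delta> where d: "\<delta> > 0" "\<And>q. degree q \<le> degree p \<Longrightarrow> \<forall>i. norm (coeff q i - coeff p i) < \<delta> \<Longrightarrow>
      norm (poly q x - poly p x) < \<eta>"
    using poly_perturb[OF \<eta>, of p x] by blast
  have "\<exists>z. poly q z = 0 \<and> norm (z - x) < \<epsilon>"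
    if q: "degree q \<le> degree p" "\<forall>i. norm (coeff q i - coeff p i) < min \<delta> (L / 2)" for q
  proof (rule ccontr)
    assume *: "\<not> ?thesis"
    have "norm (coeff q (degree p) - lead_coeff p) < L / 2" using q by auto
    moreover have "L \<le> norm (coeff q (degree p)) + norm (coeff q (degree p) - lead_coeff p)"
      unfolding L_def by norm
    ultimately have c: "norm (coeff q (degree p)) > L / 2" by simp
    then have "coeff q (degree p) \<noteq> 0" using L by auto
    then have deg: "degree q = degree p" and "q \<noteq> 0" using q(1) le_degree by (auto intro: antisym)
    then obtain A where A: "size A = degree q" "q = smult (lead_coeff q) (\<Prod>z\<in>#A. [:-z, 1:])"
      using alg_closed_imp_factorization by blast
    have "poly q z = lead_coeff q * (\<Prod>r\<in>#A. z - r)" for z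
      by (subst A(2)) (simp add: poly_prod_mset image_mset.compositionality o_def)
    then have qz: "poly q z = lead_coeff q * (\<Prod>r\<in>#A. z - r)" for z by blast
    have "norm (x - r) \<ge> \<epsilon>" if "r \<in># A" for r
    proof -
      have "poly q r = 0" unfolding qz using that by (auto simp: prod_mset_zero_iff)
      with * show ?thesis by (auto simp: norm_minus_commute not_less)
    qed
    then have "norm (\<Prod>r\<in>#A. x - r) \<ge> \<epsilon> ^ size A"
    proof (induction A)
      case (add r A)
      then show ?case using x(3) by (auto simp: norm_mult intro!: mult_mono)
    qed simp
    then have "norm (poly q x) \<ge> L / 2 * \<epsilon> ^ degree p"
      unfolding qz norm_mult using c deg A(1) L x(3) by (intro mult_mono) auto
    moreover have "norm (poly q x) < \<eta>" using d(2)[of q] q x(2) by auto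
    ultimately show False by (simp add: \<eta>_def)
  qed
  then show "\<exists>\<delta>>0. \<forall>q. degree q \<le> degree p \<longrightarrow> (\<forall>i. norm (coeff q i - coeff p i) < \<delta>) \<longrightarrow>
      (\<exists>z. poly q z = 0 \<and> norm (z - x) < \<epsilon>)"
    using d(1) L by (intro exI[of _ "min \<delta> (L / 2)"]) auto
qed

instance real :: stable_root_field
  by standard (rule stable_root_from_poly, rule stable_root_real, assumption+)

instance complex :: stable_root_field
  by standard (rule stable_root_from_poly, rule stable_root_complex, assumption+)

section \<open>Irreducibility, closure and algebraic dependence\<close>
text \<open>Equivalently, the polynomials in \<open>T\<close> vanishing on \<open>Z\<close> form a prime ideal. The notion applies to
  arbitrary point sets and is relative to \<open>T\<close>, since closed sets are built coordinate by coordinate.\<close>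
definition irreducible_on :: "'v set \<Rightarrow> ('v \<Rightarrow> 'a::comm_ring_1) set \<Rightarrow> bool" where
  "irreducible_on T Z \<longleftrightarrow> Z \<noteq> {} \<and> (\<forall>f\<in>poly_funs T. \<forall>g\<in>poly_funs T.
    (\<forall>x\<in>Z. f x * g x = 0) \<longrightarrow> (\<forall>x\<in>Z. f x = 0) \<or> (\<forall>x\<in>Z. g x = 0))"

text \<open>For \<open>T \<noteq> UNIV\<close> this is the cylinder over the Zariski closure of the projection of \<open>Z\<close> to the
  coordinates in \<open>T\<close>.\<close>
definition closure_on :: "'v set \<Rightarrow> ('v \<Rightarrow> 'a::comm_ring_1) set \<Rightarrow> ('v \<Rightarrow> 'a) set" where
  "closure_on T Z = {x. \<forall>f\<in>poly_funs T. (\<forall>z\<in>Z. f z = 0) \<longrightarrow> f x = 0}"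

definition algebraic_over :: "('v \<Rightarrow> 'a::comm_ring_1) set \<Rightarrow> 'v set \<Rightarrow> 'v \<Rightarrow> bool" where
  "algebraic_over Z T v \<longleftrightarrow> (\<exists>e c. (\<forall>i. c i \<in> poly_funs T) \<and>
    (\<forall>x\<in>Z. (\<Sum>i\<le>e. c i x * x v ^ i) = 0) \<and> (\<exists>x\<in>Z. c e x \<noteq> 0))"

definition independent_on :: "('v \<Rightarrow> 'a::comm_ring_1) set \<Rightarrow> 'v set \<Rightarrow> bool" where
  "independent_on Z B \<longleftrightarrow> (\<forall>f\<in>poly_funs B. (\<forall>x\<in>Z. f x = 0) \<longrightarrow> (\<forall>x. f x = 0))"

lemma irreducible_onD:
  assumes "irreducible_on T Z" "f \<in> poly_funs T" "g \<in> poly_funs T" "\<forall>x\<in>Z. f x * g x = 0"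
  shows "(\<forall>x\<in>Z. f x = 0) \<or> (\<forall>x\<in>Z. g x = 0)"
  using assms unfolding irreducible_on_def by blast

lemma irreducible_on_nonempty: "irreducible_on T Z \<Longrightarrow> Z \<noteq> {}"
  unfolding irreducible_on_def by (rule conjunct1)

lemma closure_onD: "x \<in> closure_on T Z \<Longrightarrow> f \<in> poly_funs T \<Longrightarrow> (\<And>z. z \<in> Z \<Longrightarrow> f z = 0) \<Longrightarrow> f x = 0"
  unfolding closure_on_def by blast

lemma closure_on_superset: "Z \<subseteq> closure_on T Z"
  unfolding closure_on_def by blast

lemma closure_on_mono: "Y \<subseteq> Z \<Longrightarrow> closure_on T Y \<subseteq> closure_on T Z"
  unfolding closure_on_def by blast

lemma closure_on_antimono: "S \<subseteq> T \<Longrightarrow> closure_on T Z \<subseteq> closure_on S Z"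
  unfolding closure_on_def using poly_funs_mono by blast

lemma closure_on_idem: "closure_on T (closure_on T Z) = closure_on T Z"
  unfolding closure_on_def by blast

lemma vanish_closure_on:
  "f \<in> poly_funs T \<Longrightarrow> (\<forall>x\<in>closure_on T Z. f x = 0) \<longleftrightarrow> (\<forall>x\<in>Z. f x = 0)"
  unfolding closure_on_def by blast

lemma irreducible_on_closure:
  assumes "irreducible_on T Z"
  shows "irreducible_on T (closure_on T Z)"
  unfolding irreducible_on_def
proof (intro conjI ballI impI)
  show "closure_on T Z \<noteq> {}"
    using irreducible_on_nonempty[OF assms] closure_on_superset[of Z T] by blast
  fix f g assume fg: "f \<in> poly_funs T" "g \<in> poly_funs T" "\<forall>x\<in>closure_on T Z. f x * g x = 0"
  then have "\<forall>x\<in>Z. f x * g x = 0" using closure_on_superset by blast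
  with irreducible_onD[OF assms fg(1,2)]
  show "(\<forall>x\<in>closure_on T Z. f x = 0) \<or> (\<forall>x\<in>closure_on T Z. g x = 0)"
    by (simp add: vanish_closure_on fg)
qed

lemma independent_onD:
  "independent_on Z B \<Longrightarrow> f \<in> poly_funs B \<Longrightarrow> (\<And>x. x \<in> Z \<Longrightarrow> f x = 0) \<Longrightarrow> f x = 0"
  unfolding independent_on_def by simp

lemma not_algebraic_over:
  assumes "\<not> algebraic_over Z T v" "\<And>i. d i \<in> poly_funs T"
    "\<forall>x\<in>Z. (\<Sum>i<n. d i x * x v ^ i) = 0"
  shows "\<forall>i<n. \<forall>x\<in>Z. d i x = 0"
proof (rule ccontr)
  assume "\<not> ?thesis"
  then have "\<exists>i<n. \<exists>x\<in>Z. d i x \<noteq> 0" by blast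
  then obtain e where "e < n" "\<exists>x\<in>Z. d e x \<noteq> 0"
    "\<And>x t. x \<in> Z \<Longrightarrow> (\<Sum>i<n. d i x * t ^ i) = (\<Sum>i\<le>e. d i x * t ^ i)"
    by (rule leading_term) blast
  with assms have "algebraic_over Z T v"
    unfolding algebraic_over_def by (intro exI[of _ e] exI[of _ d]) auto
  with assms(1) show False ..
qed

lemma algebraic_over_minimal:
  assumes "algebraic_over Z T v"
  obtains e c where "\<And>i. c i \<in> poly_funs T" "\<And>x. x \<in> Z \<Longrightarrow> (\<Sum>i\<le>e. c i x * x v ^ i) = 0"
    "\<exists>x\<in>Z. c e x \<noteq> 0"
    "\<And>d i x. (\<And>i. d i \<in> poly_funs T) \<Longrightarrow> (\<And>x. x \<in> Z \<Longrightarrow> (\<Sum>i<e. d i x * x v ^ i) = 0) \<Longrightarrow>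
      i < e \<Longrightarrow> x \<in> Z \<Longrightarrow> d i x = 0"
proof -
  define Q where "Q e \<longleftrightarrow> (\<exists>c. (\<forall>i. c i \<in> poly_funs T) \<and>
    (\<forall>x\<in>Z. (\<Sum>i\<le>e. c i x * x v ^ i) = 0) \<and> (\<exists>x\<in>Z. c e x \<noteq> 0))" for e
  define e where "e = (LEAST e. Q e)"
  have "\<exists>e. Q e" using assms unfolding algebraic_over_def Q_def .
  then have "Q e" unfolding e_def by (rule LeastI_ex)
  then obtain c where c: "\<forall>i. c i \<in> poly_funs T"
    "\<forall>x\<in>Z. (\<Sum>i\<le>e. c i x * x v ^ i) = 0" "\<exists>x\<in>Z. c e x \<noteq> 0"
    unfolding Q_def by blast
  have min: "d i x = 0" if d: "\<And>i. d i \<in> poly_funs T" "\<And>x. x \<in> Z \<Longrightarrow> (\<Sum>i<e. d i x * x v ^ i) = 0"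
    "i < e" "x \<in> Z" for d i x
  proof (rule ccontr)
    assume "d i x \<noteq> 0"
    then have "\<exists>i<e. \<exists>x\<in>Z. d i x \<noteq> 0" using d by blast
    then obtain k where k: "k < e" "\<exists>x\<in>Z. d k x \<noteq> 0"
      "\<And>x t. x \<in> Z \<Longrightarrow> (\<Sum>i<e. d i x * t ^ i) = (\<Sum>i\<le>k. d i x * t ^ i)"
      by (rule leading_term) blast
    then have "Q k" unfolding Q_def using d by (intro exI[of _ d]) auto
    with k(1) show False unfolding e_def using not_less_Least by blast
  qed
  show thesis using c min by (intro that[of c e]) blast+
qed

text \<open>A polynomial vanishing on \<open>Z\<close> has all its coefficients with respect to \<open>v\<close> vanishing on \<open>Z\<close>, so it puts
  no constraint on the value of \<open>x v\<close>.\<close>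
lemma free_coordinate:
  assumes "\<not> algebraic_over Z T v" "v \<notin> T" "x \<in> closure_on T Z"
  shows "x(v := t) \<in> closure_on (insert v T) Z"
  unfolding closure_on_def
proof (intro CollectI ballI impI)
  fix f assume f: "f \<in> poly_funs (insert v T)" "\<forall>z\<in>Z. f z = 0"
  then obtain n d where d: "\<And>i. d i \<in> poly_funs T" "f = (\<lambda>x. \<Sum>i<n. d i x * x v ^ i)"
    using poly_funs_insert_expand[OF f(1)] by (elim exE poly_inE) blast
  have "d i (x(v := t)) = 0" if "i < n" for i
  proof -
    have "d i (x(v := t)) = d i x"
      using assms(2) by (intro poly_funs_cong[OF d(1)]) auto
    moreover have "\<forall>x\<in>Z. d i x = 0"
      using not_algebraic_over[of Z T v d n] assms(1) d(1) f(2) that unfolding d(2) by blast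
    ultimately show ?thesis using closure_onD[OF assms(3) d(1)] by simp
  qed
  then show "f (x(v := t)) = 0" by (simp add: d(2))
qed

section \<open>Lifting nearby points\<close>
text \<open>In the algebraic case \<open>D\<close> is the leading coefficient of a relation of minimal degree times its
  derivative. Where \<open>D\<close> is nonzero, \<open>y v\<close> is a simple root, so a nearby \<open>x\<close> has a nearby root \<open>t\<close>. By
  pseudo-division and minimality, every polynomial that vanishes on \<open>Z\<close> becomes, after multiplication by
  a power of the leading coefficient, zero at all zeros of the relation lying over \<open>closure_on T Z\<close>.
  Thus no equation besides the minimal one has to be solved.\<close>
lemma lift_coordinate:
  fixes Z :: "('v \<Rightarrow> 'a::stable_root_field) set"
  assumes Z: "irreducible_on (insert v T) Z" and v: "v \<notin> T"
  obtains D where "D \<in> poly_funs (insert v T)" "\<exists>x\<in>Z. D x \<noteq> 0"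
    "\<And>y \<epsilon>. y \<in> closure_on (insert v T) Z \<Longrightarrow> D y \<noteq> 0 \<Longrightarrow> \<epsilon> > 0 \<Longrightarrow>
      eventually (\<lambda>x. x \<in> closure_on T Z \<longrightarrow>
        (\<exists>t. dist t (y v) < \<epsilon> \<and> x(v := t) \<in> closure_on (insert v T) Z)) (near T y)"
proof (cases "algebraic_over Z T v")
  case False
  have "\<exists>t. dist t (y v) < \<epsilon> \<and> x(v := t) \<in> closure_on (insert v T) Z"
    if "\<epsilon> > 0" "x \<in> closure_on T Z" for \<epsilon> x and y :: "'v \<Rightarrow> 'a"
    using free_coordinate[OF False v that(2)] that(1) by (intro exI[of _ "y v"]) simp
  moreover have "\<exists>x\<in>Z. (1::'a) \<noteq> 0"
    using irreducible_on_nonempty[OF Z] by auto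
  ultimately show ?thesis
    by (intro that[OF poly_funs.const[of 1]]) simp_all
next
  case True
  then obtain e c where c: "\<And>i. c i \<in> poly_funs T"
    and h0: "\<And>x. x \<in> Z \<Longrightarrow> (\<Sum>i\<le>e. c i x * x v ^ i) = 0"
    and ce: "\<exists>x\<in>Z. c e x \<noteq> 0"
    and min: "\<And>d i x. (\<And>i. d i \<in> poly_funs T) \<Longrightarrow> (\<And>x. x \<in> Z \<Longrightarrow> (\<Sum>i<e. d i x * x v ^ i) = 0) \<Longrightarrow>
      i < e \<Longrightarrow> x \<in> Z \<Longrightarrow> d i x = 0"
    by (rule algebraic_over_minimal) blast
  define h' where "h' x = (\<Sum>i\<le>e. of_nat i * c i x * x v ^ (i - 1))" for x
  have e: "e > 0" using h0 ce by (cases e) auto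
  have c': "c i \<in> poly_funs (insert v T)" for i
    using poly_funs_mono[OF _ c] by blast
  have h': "h' \<in> poly_funs (insert v T)"
    unfolding h'_def by (intro poly_funs_intros c') simp
  \<comment> \<open>the derivative \<open>h'\<close> has smaller degree and leading coefficient \<open>e * c e\<close>, which is nonzero in
    characteristic zero; so minimality of \<open>e\<close> prevents it from vanishing on \<open>Z\<close>\<close>
  have "\<exists>x\<in>Z. h' x \<noteq> 0"
  proof (rule ccontr)
    assume "\<not> ?thesis"
    then have h'0: "h' x = 0" if "x \<in> Z" for x using that by blast
    obtain k where k: "e = Suc k" using e by (cases e) auto
    have "h' x = (\<Sum>i<e. (of_nat (Suc i) * c (Suc i) x) * x v ^ i)" for x
      unfolding h'_def k by (subst sum.atMost_Suc_shift) (simp add: lessThan_Suc_atMost)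
    moreover have "(\<lambda>x. of_nat (Suc i) * c (Suc i) x) \<in> poly_funs T" for i
      by (rule poly_funs.mult[OF poly_funs.const c])
    ultimately have "of_nat (Suc k) * c (Suc k) x = 0" if "x \<in> Z" for x
      using that h'0 min[of "\<lambda>i x. of_nat (Suc i) * c (Suc i) x" k x] k
      by (auto simp del: of_nat_Suc sum.lessThan_Suc)
    with ce k show False by (auto simp del: of_nat_Suc)
  qed
  with ce irreducible_onD[OF Z c'[of e] h'] have D0: "\<exists>x\<in>Z. c e x * h' x \<noteq> 0"
    by blast
  have lift: "eventually (\<lambda>x. x \<in> closure_on T Z \<longrightarrow>
      (\<exists>t. dist t (y v) < \<epsilon> \<and> x(v := t) \<in> closure_on (insert v T) Z)) (near T y)"
    if y: "y \<in> closure_on (insert v T) Z" "c e y * h' y \<noteq> 0" and "\<epsilon> > 0" for y \<epsilon>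
  proof -
    have "(\<lambda>x. \<Sum>i\<le>e. c i x * x v ^ i) \<in> poly_funs (insert v T)"
      by (intro poly_funs_intros c') simp
    then have "(\<Sum>i\<le>e. c i y * y v ^ i) = 0"
      by (rule closure_onD[OF y(1)]) (rule h0)
    with y(2) \<open>\<epsilon> > 0\<close> obtain \<delta> where \<delta>: "\<delta> > 0" "\<And>d. (\<forall>i\<le>e. norm (d i - c i y) < \<delta>) \<Longrightarrow>
        \<exists>z. (\<Sum>i\<le>e. d i * z ^ i) = 0 \<and> norm (z - y v) < \<epsilon>"
      using stable_root[where n = e and c = "\<lambda>i. c i y" and x = "y v" and \<epsilon> = \<epsilon>] unfolding h'_def by auto
    have "eventually (\<lambda>x. \<forall>i\<in>{..e}. dist (c i x) (c i y) < \<delta>) (near T y)"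
      using \<delta>(1) by (intro eventually_ball_finite ballI tendstoD tendsto_near c) auto
    moreover have "eventually (\<lambda>x. c e x \<noteq> 0) (near T y)"
      using y(2) by (intro tendsto_imp_eventually_ne[OF tendsto_near[OF c]]) auto
    ultimately show ?thesis
    proof eventually_elim
      case (elim x)
      show ?case
      proof
        assume x: "x \<in> closure_on T Z"
        obtain t where t: "(\<Sum>i\<le>e. c i x * t ^ i) = 0" "norm (t - y v) < \<epsilon>"
          using \<delta>(2)[of "\<lambda>i. c i x"] elim(1) by (auto simp: dist_norm)
        define x' where "x' = x(v := t)"
        have eq: "f x' = f x" if "f \<in> poly_funs T" for f
          using v unfolding x'_def by (intro poly_funs_cong[OF that]) auto
        have h: "(\<Sum>i\<le>e. c i x' * x' v ^ i) = 0"
          using t(1) by (simp add: eq[OF c]) (simp add: x'_def)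
        have "x' \<in> closure_on (insert v T) Z"
          unfolding closure_on_def
        proof (intro CollectI ballI impI)
          fix f assume f: "f \<in> poly_funs (insert v T)" "\<forall>z\<in>Z. f z = 0"
          obtain n where "f \<in> poly_in T v n" using poly_funs_insert_expand[OF f(1)] by blast
          then obtain k r where r: "r \<in> poly_in T v e"
            "\<And>x. (\<Sum>i\<le>e. c i x * x v ^ i) = 0 \<Longrightarrow> c e x ^ k * f x = r x"
            using pseudo_division[of c T f v n e] c by blast
          obtain d where d: "\<And>i. d i \<in> poly_funs T" "r = (\<lambda>x. \<Sum>i<e. d i x * x v ^ i)"
            using r(1) by (rule poly_inE) blast
          have "(\<Sum>i<e. d i x * x v ^ i) = 0" if "x \<in> Z" for x
            using r(2)[OF h0[OF that]] f(2) that by (simp add: d(2))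
          then have "d i z = 0" if "i < e" "z \<in> Z" for i z
            using min[of d i z] d(1) that by blast
          then have "d i x = 0" if "i < e" for i
            using closure_onD[OF x d(1)] that by blast
          then have "r x' = 0" by (simp add: d(2) eq[OF d(1)])
          then have "c e x' ^ k * f x' = 0" using r(2)[OF h] by simp
          moreover have "c e x' \<noteq> 0" using elim(2) by (simp add: eq[OF c])
          ultimately show "f x' = 0" by simp
        qed
        with t(2) show "\<exists>t. dist t (y v) < \<epsilon> \<and> x(v := t) \<in> closure_on (insert v T) Z"
          unfolding x'_def dist_norm by blast
      qed
    qed
  qed
  show ?thesis
    by (rule that[OF poly_funs.mult[OF c'[of e] h'] D0 lift])
qed

lemma irreducible_on_mono:
  assumes "S \<subseteq> T" "irreducible_on T Z"
  shows "irreducible_on S Z"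
  unfolding irreducible_on_def
proof (intro conjI ballI impI)
  show "Z \<noteq> {}" using assms(2) by (rule irreducible_on_nonempty)
  fix f g assume fg: "f \<in> poly_funs S" "g \<in> poly_funs S" "\<forall>x\<in>Z. f x * g x = 0"
  show "(\<forall>x\<in>Z. f x = 0) \<or> (\<forall>x\<in>Z. g x = 0)"
    by (rule irreducible_onD[OF assms(2) _ _ fg(3)]) (rule poly_funs_mono[OF assms(1)], fact)+
qed

text \<open>The coordinates in \<open>U\<close> are adjoined one after the other. The lifted coordinate must stay close to
  that of \<open>y\<close>, because only then does the next lifting step apply.\<close>
lemma lift_point:
  fixes Z :: "('v \<Rightarrow> 'a::stable_root_field) set"
  assumes "finite U" "T \<inter> U = {}" "irreducible_on (T \<union> U) Z"
  obtains D where "D \<in> poly_funs (T \<union> U)" "\<exists>x\<in>Z. D x \<noteq> 0"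
    "\<And>y. y \<in> closure_on (T \<union> U) Z \<Longrightarrow> D y \<noteq> 0 \<Longrightarrow> eventually (\<lambda>x. x \<in> closure_on T Z \<longrightarrow>
      (\<exists>x'\<in>closure_on (T \<union> U) Z. \<forall>u\<in>T. x' u = x u)) (near T y)"
  using assms
proof (induction U arbitrary: T thesis rule: finite_induct)
  case empty
  have "\<exists>x\<in>Z. (1::'a) \<noteq> 0" using irreducible_on_nonempty[OF empty.prems(3)] by auto
  moreover have "eventually (\<lambda>x. x \<in> closure_on T Z \<longrightarrow>
      (\<exists>x'\<in>closure_on T Z. \<forall>u\<in>T. x' u = x u)) (near T y)" for y
    by (rule always_eventually) blast
  ultimately show ?case
    by (intro empty.prems(1)[OF poly_funs.const[of 1]]) simp_all
next
  case (insert v U)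
  let ?T = "insert v T"
  have TU: "T \<union> insert v U = ?T \<union> U" by auto
  have disj: "?T \<inter> U = {}" and irr: "irreducible_on (?T \<union> U) Z"
    using insert.prems(2,3) insert.hyps unfolding TU by auto
  obtain D1 where D1: "D1 \<in> poly_funs (T \<union> insert v U)" "\<exists>x\<in>Z. D1 x \<noteq> 0"
    "\<And>y. y \<in> closure_on (T \<union> insert v U) Z \<Longrightarrow> D1 y \<noteq> 0 \<Longrightarrow> eventually (\<lambda>x. x \<in> closure_on ?T Z \<longrightarrow>
      (\<exists>x'\<in>closure_on (T \<union> insert v U) Z. \<forall>u\<in>?T. x' u = x u)) (near ?T y)"
    by (rule insert.IH[OF _ disj irr]) (rule that; unfold TU)
  have irr2: "irreducible_on ?T Z" using insert.prems(3) by (rule irreducible_on_mono[rotated]) auto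
  have v: "v \<notin> T" using insert.prems(2) by blast
  obtain D2 where D2: "D2 \<in> poly_funs ?T" "\<exists>x\<in>Z. D2 x \<noteq> 0"
    "\<And>y \<epsilon>. y \<in> closure_on ?T Z \<Longrightarrow> D2 y \<noteq> 0 \<Longrightarrow> \<epsilon> > 0 \<Longrightarrow> eventually (\<lambda>x. x \<in> closure_on T Z \<longrightarrow>
      (\<exists>t. dist t (y v) < \<epsilon> \<and> x(v := t) \<in> closure_on ?T Z)) (near T y)"
    by (rule lift_coordinate[OF irr2 v]) (rule that)
  have D2': "D2 \<in> poly_funs (T \<union> insert v U)"
    using D2(1) by (rule poly_funs_mono[rotated]) auto
  have "\<exists>x\<in>Z. D1 x * D2 x \<noteq> 0"
    using irreducible_onD[OF insert.prems(3) D1(1) D2'] D1(2) D2(2) by blast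
  moreover have "eventually (\<lambda>x. x \<in> closure_on T Z \<longrightarrow>
      (\<exists>x'\<in>closure_on (T \<union> insert v U) Z. \<forall>u\<in>T. x' u = x u)) (near T y)"
    if y: "y \<in> closure_on (T \<union> insert v U) Z" "D1 y * D2 y \<noteq> 0" for y
  proof -
    obtain d where d: "d > 0" "\<And>x. (\<forall>u\<in>?T. dist (x u) (y u) < d) \<Longrightarrow> x \<in> closure_on ?T Z \<Longrightarrow>
        \<exists>x'\<in>closure_on (T \<union> insert v U) Z. \<forall>u\<in>?T. x' u = x u"
      using D1(3)[OF y(1)] y(2) unfolding eventually_near by auto
    have "?T \<subseteq> T \<union> insert v U" by auto
    then have "y \<in> closure_on ?T Z" using y(1) closure_on_antimono by blast
    with D2(3) y(2) d(1) have "eventually (\<lambda>x. x \<in> closure_on T Z \<longrightarrow>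
      (\<exists>t. dist t (y v) < d \<and> x(v := t) \<in> closure_on ?T Z)) (near T y)" by auto
    moreover have "eventually (\<lambda>x. \<forall>u\<in>T. dist (x u) (y u) < d) (near T y)"
      unfolding eventually_near using d(1) by blast
    ultimately show ?thesis
    proof eventually_elim
      case (elim x)
      show ?case
      proof
        assume "x \<in> closure_on T Z"
        with elim(1) obtain t where t: "dist t (y v) < d" "x(v := t) \<in> closure_on ?T Z" by blast
        have "\<forall>u\<in>?T. dist ((x(v := t)) u) (y u) < d" using elim(2) t(1) by auto
        from d(2)[OF this t(2)] obtain x' where
          x': "x' \<in> closure_on (T \<union> insert v U) Z" "\<forall>u\<in>?T. x' u = (x(v := t)) u" by blast
        have "\<forall>u\<in>T. x' u = x u"
          using x'(2) insert.prems(2) by auto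
        with x'(1) show "\<exists>x'\<in>closure_on (T \<union> insert v U) Z. \<forall>u\<in>T. x' u = x u" by blast
      qed
    qed
  qed
  ultimately show ?case
    by (rule insert.prems(1)[OF poly_funs.mult[OF D1(1) D2']])
qed

lemma lift_point_closed:
  fixes Z :: "('v::finite \<Rightarrow> 'a::stable_root_field) set"
  assumes Z: "irreducible_on UNIV Z" "closure_on UNIV Z = Z"
  obtains D where "D \<in> poly_funs UNIV" "\<exists>x\<in>Z. D x \<noteq> 0"
    "\<And>y. y \<in> Z \<Longrightarrow> D y \<noteq> 0 \<Longrightarrow> \<exists>d>0. \<forall>x\<in>closure_on T Z. (\<forall>u\<in>T. dist (x u) (y u) < d) \<longrightarrow>
      (\<exists>x'\<in>Z. \<forall>u\<in>T. x' u = x u)"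
proof -
  have U: "T \<union> - T = UNIV" by blast
  have irr: "irreducible_on (T \<union> - T) Z" unfolding U by (rule Z(1))
  show thesis
  proof (rule lift_point[OF _ _ irr, of thesis])
    fix D assume D: "D \<in> poly_funs (T \<union> - T)" "\<exists>x\<in>Z. D x \<noteq> 0"
      "\<And>y. y \<in> closure_on (T \<union> - T) Z \<Longrightarrow> D y \<noteq> 0 \<Longrightarrow> eventually (\<lambda>x. x \<in> closure_on T Z \<longrightarrow>
        (\<exists>x'\<in>closure_on (T \<union> - T) Z. \<forall>u\<in>T. x' u = x u)) (near T y)"
    show thesis
    proof (rule that[of D])
      show "D \<in> poly_funs UNIV" "\<exists>x\<in>Z. D x \<noteq> 0"
        using D(1,2) unfolding U by blast+
      fix y assume "y \<in> Z" "D y \<noteq> 0"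
      then have "eventually (\<lambda>x. x \<in> closure_on T Z \<longrightarrow> (\<exists>x'\<in>Z. \<forall>u\<in>T. x' u = x u)) (near T y)"
        using D(3)[of y] unfolding U Z(2) by simp
      then obtain d where "d > 0" "\<forall>x. (\<forall>u\<in>T. dist (x u) (y u) < d) \<longrightarrow>
          x \<in> closure_on T Z \<longrightarrow> (\<exists>x'\<in>Z. \<forall>u\<in>T. x' u = x u)"
        unfolding eventually_near by (elim exE conjE) (rule that)
      then show "\<exists>d>0. \<forall>x\<in>closure_on T Z. (\<forall>u\<in>T. dist (x u) (y u) < d) \<longrightarrow>
          (\<exists>x'\<in>Z. \<forall>u\<in>T. x' u = x u)"
        by (intro exI[of _ d]) simp
    qed
  qed auto
qed

section \<open>Infinite fibres and slices\<close>
lemma infinite_ball_field: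
  fixes a :: "'a::real_normed_field"
  assumes "d > 0"
  shows "infinite {t. dist t a < d}"
proof
  assume "finite {t. dist t a < d}"
  moreover have "(\<lambda>s. a + of_real s) ` {0<..<d} \<subseteq> {t. dist t a < d}"
    by (auto simp: dist_norm)
  ultimately have "finite ((\<lambda>s. a + of_real s) ` {0<..<d})"
    by (rule finite_subset[rotated])
  then have "finite {0<..<d}" by (rule finite_imageD) (auto simp: inj_on_def)
  with assms show False by (simp add: infinite_Ioo)
qed

lemma algebraic_over_self: "v \<in> T \<Longrightarrow> Z \<noteq> {} \<Longrightarrow> algebraic_over Z T v"
  unfolding algebraic_over_def
  by (intro exI[of _ 1] exI[of _ "\<lambda>i. if i = 0 then (\<lambda>x. - x v) else (\<lambda>_. 1)"])
    (auto intro: poly_funs_intros)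

text \<open>Near a generic point \<open>y\<close> the coordinate \<open>b\<close> can be varied freely with those in \<open>S\<close> held fixed, and all
  resulting points lift to \<open>Z\<close>.\<close>
lemma infinite_fibre:
  fixes Z :: "('v::finite \<Rightarrow> 'a::stable_root_field) set"
  assumes Z: "irreducible_on UNIV Z" "closure_on UNIV Z = Z"
    and b: "\<not> algebraic_over Z S b"
    and g: "g \<in> poly_funs UNIV" "\<exists>x\<in>Z. g x \<noteq> 0"
  shows "\<exists>y\<in>Z. g y \<noteq> 0 \<and> infinite ((\<lambda>x. x b) ` {x\<in>Z. \<forall>s\<in>S. x s = y s})"
proof -
  have bS: "b \<notin> S"
    using b algebraic_over_self[of b S Z] irreducible_on_nonempty[OF Z(1)] by blast
  let ?T = "insert b S"
  obtain D where D: "D \<in> poly_funs UNIV" "\<exists>x\<in>Z. D x \<noteq> 0"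
    "\<And>y. y \<in> Z \<Longrightarrow> D y \<noteq> 0 \<Longrightarrow> \<exists>d>0. \<forall>x\<in>closure_on ?T Z.
      (\<forall>u\<in>?T. dist (x u) (y u) < d) \<longrightarrow> (\<exists>x'\<in>Z. \<forall>u\<in>?T. x' u = x u)"
    by (rule lift_point_closed[OF Z, of ?T]) (rule that)
  have "\<not> (\<forall>x\<in>Z. g x * D x = 0)"
    using irreducible_onD[OF Z(1) g(1) D(1)] g(2) D(2) by blast
  then obtain y where y: "y \<in> Z" "g y \<noteq> 0" "D y \<noteq> 0" by auto
  obtain d where d: "d > 0" "\<forall>x\<in>closure_on ?T Z. (\<forall>u\<in>?T. dist (x u) (y u) < d) \<longrightarrow>
      (\<exists>x'\<in>Z. \<forall>u\<in>?T. x' u = x u)"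
    using D(3)[OF y(1,3)] by (elim exE conjE) (rule that)
  have "{t. dist t (y b) < d} \<subseteq> (\<lambda>x. x b) ` {x\<in>Z. \<forall>s\<in>S. x s = y s}"
  proof
    fix t assume t: "t \<in> {t. dist t (y b) < d}"
    have "y \<in> closure_on S Z" using y(1) closure_on_superset by blast
    then have "y(b := t) \<in> closure_on ?T Z" by (rule free_coordinate[OF b bS])
    moreover have "\<forall>u\<in>?T. dist ((y(b := t)) u) (y u) < d" using t d(1) by auto
    ultimately obtain x' where x': "x' \<in> Z" "\<forall>u\<in>?T. x' u = (y(b := t)) u" using d(2) by blast
    then have "\<forall>s\<in>S. x' s = y s" "x' b = t" using bS by auto
    with x'(1) show "t \<in> (\<lambda>x. x b) ` {x\<in>Z. \<forall>s\<in>S. x s = y s}" by blast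
  qed
  then have "infinite ((\<lambda>x. x b) ` {x\<in>Z. \<forall>s\<in>S. x s = y s})"
    using infinite_ball_field[OF d(1), of "y b"] finite_subset by blast
  with y show ?thesis by blast
qed

text \<open>For independent coordinates \<open>closure_on (insert b B) Z\<close> is the whole space, so all values of the
  coordinates in \<open>B\<close> close to those of a generic point \<open>y\<close> occur on the slice through \<open>y\<close>. A polynomial
  vanishing on an open box is zero.\<close>
lemma independent_slice:
  fixes Z :: "('v::finite \<Rightarrow> 'a::stable_root_field) set"
  assumes Z: "irreducible_on UNIV Z" "closure_on UNIV Z = Z"
    and B: "independent_on Z (insert b B)" "b \<notin> B"
  shows "\<exists>c. independent_on {x\<in>Z. x b = c} B"
proof -
  let ?T = "insert b B"
  obtain D where D: "D \<in> poly_funs UNIV" "\<exists>x\<in>Z. D x \<noteq> 0"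
    "\<And>y. y \<in> Z \<Longrightarrow> D y \<noteq> 0 \<Longrightarrow> \<exists>d>0. \<forall>x\<in>closure_on ?T Z.
      (\<forall>u\<in>?T. dist (x u) (y u) < d) \<longrightarrow> (\<exists>x'\<in>Z. \<forall>u\<in>?T. x' u = x u)"
    by (rule lift_point_closed[OF Z, of ?T]) (rule that)
  obtain y where y: "y \<in> Z" "D y \<noteq> 0" using D(2) by blast
  have "closure_on ?T Z = UNIV"
    using independent_onD[OF B(1)] unfolding closure_on_def by auto
  with D(3)[OF y] obtain d where d: "d > 0" "\<forall>x. (\<forall>u\<in>?T. dist (x u) (y u) < d) \<longrightarrow>
      (\<exists>x'\<in>Z. \<forall>u\<in>?T. x' u = x u)"
    by (simp only: UNIV_I simp_thms ball_UNIV) (elim exE conjE, rule that)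
  have "f x = 0" if f: "f \<in> poly_funs B" "\<forall>x\<in>{x\<in>Z. x b = y b}. f x = 0" for f x
  proof (rule poly_funs_eq_0_if_near[OF f(1)])
    show "eventually (\<lambda>x. f x = 0) (near B y)"
      unfolding eventually_near
    proof (intro exI[of _ d] conjI allI impI d(1))
      fix x assume x: "\<forall>v\<in>B. dist (x v) (y v) < d"
      then have "\<forall>u\<in>?T. dist ((x(b := y b)) u) (y u) < d" using d(1) by auto
      then obtain x' where x': "x' \<in> Z" "\<forall>u\<in>?T. x' u = (x(b := y b)) u" using d(2) by blast
      have "f x = f x'" using x'(2) B(2) by (intro poly_funs_cong[OF f(1)]) auto
      also have "\<dots> = 0" using f(2) x' by auto
      finally show "f x = 0" .
    qed
  qed simp
  then show ?thesis unfolding independent_on_def by (intro exI[of _ "y b"]) simp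
qed

section \<open>Irreducible subsets of a slice\<close>
text \<open>Density as seen by the coordinates in \<open>T\<close>. For irreducible \<open>G\<close> one of finitely many sets covering a
  dense set is dense, which replaces the decomposition into irreducible components.\<close>
definition dense_in :: "'v set \<Rightarrow> ('v \<Rightarrow> 'a::comm_ring_1) set \<Rightarrow> ('v \<Rightarrow> 'a) set \<Rightarrow> bool" where
  "dense_in T A G \<longleftrightarrow> (\<forall>f\<in>poly_funs T. (\<forall>x\<in>A. f x = 0) \<longrightarrow> (\<forall>x\<in>G. f x = 0))"

lemma dense_inD:
  "dense_in T A G \<Longrightarrow> f \<in> poly_funs T \<Longrightarrow> (\<And>x. x \<in> A \<Longrightarrow> f x = 0) \<Longrightarrow> x \<in> G \<Longrightarrow> f x = 0"
  unfolding dense_in_def by simp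

lemma dense_in_mono: "A \<subseteq> B \<Longrightarrow> dense_in T A G \<Longrightarrow> dense_in T B G"
  unfolding dense_in_def by auto

lemma dense_in_refl: "dense_in T G G"
  unfolding dense_in_def by simp

lemma dense_in_Un:
  assumes "irreducible_on T G" "dense_in T (A \<union> B) G"
  shows "dense_in T A G \<or> dense_in T B G"
proof (rule ccontr)
  assume "\<not> ?thesis"
  then obtain f g where f: "f \<in> poly_funs T" "\<forall>x\<in>A. f x = 0" "\<not> (\<forall>x\<in>G. f x = 0)"
    and g: "g \<in> poly_funs T" "\<forall>x\<in>B. g x = 0" "\<not> (\<forall>x\<in>G. g x = 0)"
    unfolding dense_in_def by blast
  have "\<forall>x\<in>A \<union> B. f x * g x = 0" using f(2) g(2) by auto
  then have "\<forall>x\<in>G. f x * g x = 0"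
    using dense_inD[OF assms(2) poly_funs.mult[OF f(1) g(1)]] by simp
  from irreducible_onD[OF assms(1) f(1) g(1) this] f(3) g(3) show False by blast
qed

text \<open>If \<open>f * g\<close> vanishes on \<open>G'\<close>, the zeros of \<open>f\<close> or those of \<open>g\<close> in \<open>G'\<close> are dense. Hence irreducibility
  only requires that polynomials with densely many zeros in \<open>G'\<close> vanish on \<open>G'\<close>.\<close>
lemma irreducible_onI_dense:
  fixes G :: "('v \<Rightarrow> 'a::idom) set"
  assumes G: "irreducible_on T G" "dense_in T G' G"
    and *: "\<And>f. f \<in> poly_funs U \<Longrightarrow> dense_in T {x\<in>G'. f x = 0} G \<Longrightarrow> \<forall>x\<in>G'. f x = 0"
  shows "irreducible_on U G'"
  unfolding irreducible_on_def
proof (intro conjI ballI impI notI)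
  assume "G' = {}"
  then have "\<forall>x\<in>G. False" using dense_inD[OF G(2) poly_funs.const[of 1]] by auto
  with irreducible_on_nonempty[OF G(1)] show False by blast
next
  fix f g assume fg: "f \<in> poly_funs U" "g \<in> poly_funs U" "\<forall>x\<in>G'. f x * g x = 0"
  then have "G' \<subseteq> {x\<in>G'. f x = 0} \<union> {x\<in>G'. g x = 0}" by auto
  from dense_in_Un[OF G(1) dense_in_mono[OF this G(2)]]
  have "dense_in T {x\<in>G'. f x = 0} G \<or> dense_in T {x\<in>G'. g x = 0} G"
    .
  with *[OF fg(1)] *[OF fg(2)] show "(\<forall>x\<in>G'. f x = 0) \<or> (\<forall>x\<in>G'. g x = 0)" by blast
qed

text \<open>If no polynomial that genuinely involves \<open>v\<close> has densely many zeros in \<open>G\<close>, then \<open>G\<close> itself is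
  irreducible for the larger set of coordinates. Otherwise \<open>G'\<close> consists of the zeros of such a polynomial of
  minimal degree: another polynomial with densely many zeros in \<open>G'\<close> leaves a remainder whose
  coefficients vanish on \<open>G\<close>, by minimality.\<close>
lemma refine_coordinate:
  fixes G :: "('v \<Rightarrow> 'a::idom) set"
  assumes G: "irreducible_on T G"
  shows "\<exists>G'\<subseteq>G. irreducible_on (insert v T) G' \<and> dense_in T G' G"
proof -
  define Q where "Q e \<longleftrightarrow> (\<exists>c. (\<forall>i. c i \<in> poly_funs T) \<and> (\<exists>x\<in>G. c e x \<noteq> 0) \<and>
    dense_in T {x\<in>G. (\<Sum>i\<le>e. c i x * x v ^ i) = 0} G)" for e
  have key: "\<forall>i<m. \<forall>x\<in>G. d i x = 0"
    if m: "\<And>k. k < m \<Longrightarrow> \<not> Q k" and d: "\<And>i. d i \<in> poly_funs T"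
      and A: "A \<subseteq> G" "dense_in T A G" "\<forall>x\<in>A. (\<Sum>i<m. d i x * x v ^ i) = 0" for m d A
  proof (rule ccontr)
    assume "\<not> ?thesis"
    then have "\<exists>i<m. \<exists>x\<in>G. d i x \<noteq> 0" by blast
    then obtain k where k: "k < m" "\<exists>x\<in>G. d k x \<noteq> 0"
      "\<And>x t. x \<in> G \<Longrightarrow> (\<Sum>i<m. d i x * t ^ i) = (\<Sum>i\<le>k. d i x * t ^ i)"
      by (rule leading_term) blast
    have "A \<subseteq> {x\<in>G. (\<Sum>i\<le>k. d i x * x v ^ i) = 0}"
    proof
      fix x assume "x \<in> A"
      then show "x \<in> {x\<in>G. (\<Sum>i\<le>k. d i x * x v ^ i) = 0}"
        using A(1,3) k(3)[of x "x v"] by auto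
    qed
    then have "dense_in T {x\<in>G. (\<Sum>i\<le>k. d i x * x v ^ i) = 0} G"
      using A(2) by (rule dense_in_mono)
    then have "Q k" unfolding Q_def using d k(2) by (intro exI[of _ d]) auto
    with m[OF k(1)] show False ..
  qed
  show ?thesis
  proof (cases "\<exists>e. Q e")
    case False
    have "irreducible_on (insert v T) G"
    proof (rule irreducible_onI_dense[OF G])
      fix f assume f: "f \<in> poly_funs (insert v T)" "dense_in T {x\<in>G. f x = 0} G"
      then obtain n d where d: "\<And>i. d i \<in> poly_funs T" "f = (\<lambda>x. \<Sum>i<n. d i x * x v ^ i)"
        using poly_funs_insert_expand[OF f(1)] by (elim exE poly_inE) blast
      have "\<forall>i<n. \<forall>x\<in>G. d i x = 0"
        using False by (intro key[OF _ d(1) _ f(2)]) (auto simp: d(2))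
      then show "\<forall>x\<in>G. f x = 0" by (simp add: d(2))
    qed (rule dense_in_refl)
    then show ?thesis by (intro exI[of _ G]) (simp add: dense_in_refl)
  next
    case True
    define e where "e = (LEAST e. Q e)"
    have "Q e" unfolding e_def using True by (rule LeastI_ex)
    then obtain c where c: "\<And>i. c i \<in> poly_funs T" "\<exists>x\<in>G. c e x \<noteq> 0"
      "dense_in T {x\<in>G. (\<Sum>i\<le>e. c i x * x v ^ i) = 0} G"
      unfolding Q_def by blast
    have min: "\<And>k. k < e \<Longrightarrow> \<not> Q k" unfolding e_def by (rule not_less_Least)
    \<comment> \<open>points with vanishing leading coefficient are discarded, so that the factor produced by
      pseudo-division can be cancelled\<close>
    define G' where "G' = {x\<in>G. (\<Sum>i\<le>e. c i x * x v ^ i) = 0 \<and> c e x \<noteq> 0}"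
    have "{x\<in>G. (\<Sum>i\<le>e. c i x * x v ^ i) = 0} \<subseteq>
        {x\<in>G. (\<Sum>i\<le>e. c i x * x v ^ i) = 0 \<and> c e x = 0} \<union> G'"
      unfolding G'_def by auto
    from dense_in_Un[OF G dense_in_mono[OF this c(3)]]
    have "dense_in T {x\<in>G. (\<Sum>i\<le>e. c i x * x v ^ i) = 0 \<and> c e x = 0} G \<or> dense_in T G' G" .
    moreover have "\<not> dense_in T {x\<in>G. (\<Sum>i\<le>e. c i x * x v ^ i) = 0 \<and> c e x = 0} G"
      using dense_inD[OF _ c(1)[of e]] c(2) by blast
    ultimately have dense: "dense_in T G' G"
      by blast
    have "irreducible_on (insert v T) G'"
    proof (rule irreducible_onI_dense[OF G dense])
      fix f assume f: "f \<in> poly_funs (insert v T)" "dense_in T {x\<in>G'. f x = 0} G"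
      obtain n where "f \<in> poly_in T v n" using poly_funs_insert_expand[OF f(1)] by blast
      then obtain k r where r: "r \<in> poly_in T v e"
        "\<And>x. (\<Sum>i\<le>e. c i x * x v ^ i) = 0 \<Longrightarrow> c e x ^ k * f x = r x"
        using pseudo_division[of c T f v n e] c(1) by blast
      obtain d where d: "\<And>i. d i \<in> poly_funs T" "r = (\<lambda>x. \<Sum>i<e. d i x * x v ^ i)"
        using r(1) by (rule poly_inE) blast
      have "\<forall>i<e. \<forall>x\<in>G. d i x = 0"
      proof (rule key[OF min d(1) _ f(2)])
        show "{x\<in>G'. f x = 0} \<subseteq> G" unfolding G'_def by blast
        show "\<forall>x\<in>{x\<in>G'. f x = 0}. (\<Sum>i<e. d i x * x v ^ i) = 0"
        proof
          fix x assume "x \<in> {x\<in>G'. f x = 0}"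
          then have "r x = 0" using r(2)[of x] unfolding G'_def by simp
          then show "(\<Sum>i<e. d i x * x v ^ i) = 0" by (simp add: d(2))
        qed
      qed
      then have "r x = 0" if "x \<in> G" for x using that by (simp add: d(2))
      then have "c e x ^ k * f x = 0" if "x \<in> G'" for x
        using r(2)[of x] that unfolding G'_def by simp
      then show "\<forall>x\<in>G'. f x = 0"
        unfolding G'_def by simp
    qed
    moreover have "G' \<subseteq> G" unfolding G'_def by blast
    ultimately show ?thesis using dense by (intro exI[of _ G'] conjI)
  qed
qed

lemma refine_irreducible:
  fixes G :: "('v \<Rightarrow> 'a::idom) set"
  assumes "finite U" "irreducible_on T G"
  shows "\<exists>G'\<subseteq>G. irreducible_on (T \<union> U) G' \<and> dense_in T G' G"
  using assms
proof (induction U rule: finite_induct)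
  case empty
  then show ?case by (intro exI[of _ G]) (simp add: dense_in_refl)
next
  case (insert v U)
  then obtain G1 where G1: "G1 \<subseteq> G" "irreducible_on (T \<union> U) G1" "dense_in T G1 G" by blast
  obtain G2 where G2: "G2 \<subseteq> G1" "irreducible_on (insert v (T \<union> U)) G2" "dense_in (T \<union> U) G2 G1"
    using refine_coordinate[OF G1(2)] by blast
  have "dense_in T G2 G"
    unfolding dense_in_def
  proof (intro ballI impI)
    fix f x assume f: "f \<in> poly_funs T" "\<forall>x\<in>G2. f x = 0" and x: "x \<in> G"
    have "f \<in> poly_funs (T \<union> U)" using f(1) by (rule poly_funs_mono[rotated]) simp
    then have "f x = 0" if "x \<in> G1" for x
      using dense_inD[OF G2(3) _ _ that] f(2) by simp
    then show "f x = 0" using dense_inD[OF G1(3) f(1) _ x] by simp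
  qed
  with G1 G2 show ?case by (intro exI[of _ G2]) auto
qed

text \<open>Induction on \<open>B\<close>: the slice \<open>x b = c\<close> contains an irreducible set on which \<open>B\<close> without \<open>b\<close> is
  independent. Its closure is a proper subset of \<open>Z\<close>, because \<open>x b - c\<close> vanishes on it but, by independence of
  \<open>b\<close>, not on \<open>Z\<close>.\<close>
lemma chain_of_independent:
  fixes Z :: "('v::finite \<Rightarrow> 'a::stable_root_field) set"
  assumes "finite B" "irreducible_on UNIV Z" "closure_on UNIV Z = Z" "independent_on Z B"
  shows "\<exists>W. (\<forall>i\<le>card B. irreducible_on UNIV (W i) \<and> closure_on UNIV (W i) = W i) \<and>
    (\<forall>i<card B. W i \<subset> W (Suc i)) \<and> W (card B) = Z"
  using assms
proof (induction B arbitrary: Z rule: finite_induct)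
  case empty
  then show ?case by (intro exI[of _ "\<lambda>_. Z"]) auto
next
  case (insert b B)
  obtain c where c: "independent_on {x\<in>Z. x b = c} B"
    using independent_slice[OF insert.prems insert.hyps(2)] by blast
  define G where "G = {x\<in>Z. x b = c}"
  have G0: "\<forall>x. f x = 0" if "f \<in> poly_funs B" "\<forall>x\<in>G. f x = 0" for f
    using independent_onD[OF c that(1)] that(2) unfolding G_def by simp
  have "irreducible_on B G"
    unfolding irreducible_on_def
  proof (intro conjI notI ballI impI)
    assume "G = {}"
    with G0[of "\<lambda>_. 1"] show False by (simp add: poly_funs.const)
  next
    fix f g assume fg: "f \<in> poly_funs B" "g \<in> poly_funs B" "\<forall>x\<in>G. f x * g x = 0"
    then have "f x * g x = 0" for x using G0[OF poly_funs.mult[OF fg(1,2)]] by simp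
    from poly_funs_no_zero_divisors[OF fg(1,2) this]
    show "(\<forall>x\<in>G. f x = 0) \<or> (\<forall>x\<in>G. g x = 0)" by blast
  qed
  from refine_irreducible[OF finite[of UNIV] this]
  obtain G' where G': "G' \<subseteq> G" "irreducible_on UNIV G'" "dense_in B G' G"
    unfolding Un_UNIV_right by (elim exE conjE) (rule that)
  define Z' where "Z' = closure_on UNIV G'"
  have Z': "irreducible_on UNIV Z'" "closure_on UNIV Z' = Z'"
    unfolding Z'_def using irreducible_on_closure[OF G'(2)] by (simp_all add: closure_on_idem)
  have sub: "G' \<subseteq> Z'" unfolding Z'_def by (rule closure_on_superset)
  have "independent_on Z' B"
    unfolding independent_on_def
  proof (intro ballI impI)
    fix f assume f: "f \<in> poly_funs B" "\<forall>x\<in>Z'. f x = 0"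
    then have "\<forall>x\<in>G. f x = 0"
      using dense_inD[OF G'(3) f(1)] sub by blast
    with f(1) show "\<forall>x. f x = 0" by (rule G0)
  qed
  from insert.IH[OF Z' this] obtain W where W:
    "\<forall>i\<le>card B. irreducible_on UNIV (W i) \<and> closure_on UNIV (W i) = W i"
    "\<forall>i<card B. W i \<subset> W (Suc i)" "W (card B) = Z'" by (elim exE conjE) (rule that)
  have "Z' \<subseteq> Z"
    using closure_on_mono[of G' Z UNIV] G'(1) insert.prems(2) unfolding Z'_def G_def by blast
  moreover have "Z' \<noteq> Z"
  proof
    assume "Z' = Z"
    have "(\<lambda>x. x b - c) \<in> poly_funs UNIV" by (intro poly_funs_intros) simp
    then have "\<forall>x\<in>Z'. x b - c = 0"
      unfolding Z'_def using G'(1) by (subst vanish_closure_on) (auto simp: G_def)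
    then have vanish: "\<And>x. x \<in> Z \<Longrightarrow> x b - c = 0" using \<open>Z' = Z\<close> by simp
    have poly: "(\<lambda>x. x b - c) \<in> poly_funs (insert b B)" by (intro poly_funs_intros) simp
    have "x b - c = 0" for x
      by (rule independent_onD[OF insert.prems(3) poly]) (rule vanish)
    from this[of "\<lambda>_. c + 1"] show False by simp
  qed
  ultimately have "Z' \<subset> Z" by blast
  define W' where "W' = W(Suc (card B) := Z)"
  have "W' i \<subset> W' (Suc i)" if "i < Suc (card B)" for i
    using W(2,3) \<open>Z' \<subset> Z\<close> that unfolding W'_def by (cases "i = card B") auto
  moreover have "irreducible_on UNIV (W' i) \<and> closure_on UNIV (W' i) = W' i" if "i \<le> Suc (card B)" for i
    using W(1) insert.prems that unfolding W'_def by auto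
  moreover have "W' (Suc (card B)) = Z" unfolding W'_def by simp
  ultimately show ?case
    using insert.hyps by (intro exI[of _ W']) simp
qed

section \<open>The dimension bound by counting monomials\<close>
text \<open>Gaussian elimination of one equation at a time.\<close>
lemma homogeneous_system_solution:
  fixes b :: "'i \<Rightarrow> 'j \<Rightarrow> 'a::field"
  assumes "finite G" "finite A" "card G < card A"
  shows "\<exists>a. (\<exists>\<alpha>\<in>A. a \<alpha> \<noteq> 0) \<and> (\<forall>\<gamma>\<in>G. (\<Sum>\<alpha>\<in>A. a \<alpha> * b \<alpha> \<gamma>) = 0)"
  using assms
proof (induction G arbitrary: A b rule: finite_induct)
  case empty
  then have "A \<noteq> {}" by auto
  then show ?case by (intro exI[of _ "\<lambda>_. 1"]) auto
next
  case (insert \<gamma> G)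
  show ?case
  proof (cases "\<forall>\<alpha>\<in>A. b \<alpha> \<gamma> = 0")
    case True
    have "card G < card A" using insert by simp
    then obtain a where "\<exists>\<alpha>\<in>A. a \<alpha> \<noteq> 0" "\<forall>\<gamma>\<in>G. (\<Sum>\<alpha>\<in>A. a \<alpha> * b \<alpha> \<gamma>) = 0"
      using insert.IH[of A b] insert.prems by auto
    with True show ?thesis by (intro exI[of _ a]) simp
  next
    case False
    then obtain p where p: "p \<in> A" "b p \<gamma> \<noteq> 0" by blast
    define b' where "b' \<alpha> \<delta> = b \<alpha> \<delta> - b \<alpha> \<gamma> / b p \<gamma> * b p \<delta>" for \<alpha> \<delta>
    have "card G < card (A - {p})" using insert p(1) by simp
    then obtain a where a: "\<exists>\<alpha>\<in>A - {p}. a \<alpha> \<noteq> 0"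
      "\<And>\<delta>. \<delta> \<in> G \<Longrightarrow> (\<Sum>\<alpha>\<in>A - {p}. a \<alpha> * b' \<alpha> \<delta>) = 0"
      using insert.IH[of "A - {p}" b'] insert.prems by auto
    define q where "q = - (\<Sum>\<alpha>\<in>A - {p}. a \<alpha> * (b \<alpha> \<gamma> / b p \<gamma>))"
    have sum: "(\<Sum>\<alpha>\<in>A. (a(p := q)) \<alpha> * b \<alpha> \<delta>) = (\<Sum>\<alpha>\<in>A - {p}. a \<alpha> * b' \<alpha> \<delta>)" for \<delta>
    proof -
      have "(\<Sum>\<alpha>\<in>A. (a(p := q)) \<alpha> * b \<alpha> \<delta>) = q * b p \<delta> + (\<Sum>\<alpha>\<in>A - {p}. a \<alpha> * b \<alpha> \<delta>)"
        using insert.prems(1) p(1) by (simp add: sum.remove[of A p])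
      then show ?thesis
        unfolding q_def b'_def
        by (simp add: right_diff_distrib sum_subtractf sum_distrib_right mult.assoc)
    qed
    have "b' \<alpha> \<gamma> = 0" for \<alpha> using p(2) by (simp add: b'_def)
    then have "\<forall>\<delta>\<in>insert \<gamma> G. (\<Sum>\<alpha>\<in>A. (a(p := q)) \<alpha> * b \<alpha> \<delta>) = 0"
      unfolding sum using a(2) by auto
    moreover have "\<exists>\<alpha>\<in>A. (a(p := q)) \<alpha> \<noteq> 0" using a(1) by auto
    ultimately show ?thesis by blast
  qed
qed

text \<open>Exponents of the monomials that remain after every coordinate \<open>v\<close> outside \<open>S\<close> has been reduced by an
  equation of degree \<open>e v\<close>. Their number grows like \<open>M ^ card S\<close>.\<close>
definition bounded_exps :: "'v set \<Rightarrow> ('v \<Rightarrow> nat) \<Rightarrow> nat \<Rightarrow> ('v \<Rightarrow> nat) set" where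
  "bounded_exps S e M = (\<Pi>\<^sub>E v\<in>UNIV. if v \<in> S then {..M} else {..<e v})"

definition monomial :: "('v::finite \<Rightarrow> nat) \<Rightarrow> ('v \<Rightarrow> 'a::comm_ring_1) \<Rightarrow> 'a" where
  "monomial \<gamma> x = (\<Prod>v\<in>UNIV. x v ^ \<gamma> v)"

text \<open>Equality is required on \<open>Z\<close> only, so that the relations holding on \<open>Z\<close> can be used to reduce
  exponents.\<close>
definition monomial_span ::
  "('v::finite \<Rightarrow> 'a::comm_ring_1) set \<Rightarrow> 'v set \<Rightarrow> ('v \<Rightarrow> nat) \<Rightarrow> nat \<Rightarrow> (('v \<Rightarrow> 'a) \<Rightarrow> 'a) set" where
  "monomial_span Z S e M =
    {g. \<exists>a. \<forall>x\<in>Z. g x = (\<Sum>\<gamma>\<in>bounded_exps S e M. a \<gamma> * monomial \<gamma> x)}"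

text \<open>Multiplication by \<open>f\<close> raises the exponent bound by at most \<open>c\<close>, uniformly in \<open>M\<close>. Products of many
  such functions therefore stay within a bound that is linear in their number.\<close>
definition span_shift ::
  "('v::finite \<Rightarrow> 'a::comm_ring_1) set \<Rightarrow> 'v set \<Rightarrow> ('v \<Rightarrow> nat) \<Rightarrow> (('v \<Rightarrow> 'a) \<Rightarrow> 'a) \<Rightarrow> nat \<Rightarrow> bool" where
  "span_shift Z S e f c \<longleftrightarrow>
    (\<forall>M. \<forall>g\<in>monomial_span Z S e M. (\<lambda>x. f x * g x) \<in> monomial_span Z S e (M + c))"

lemma finite_bounded_exps: "finite (bounded_exps S e M :: ('v::finite \<Rightarrow> nat) set)"
  unfolding bounded_exps_def by (intro finite_PiE) auto

lemma card_bounded_exps: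
  "card (bounded_exps S e M :: ('v::finite \<Rightarrow> nat) set) = Suc M ^ card S * (\<Prod>v\<in>-S. e v)"
proof -
  have "card (bounded_exps S e M) = (\<Prod>v\<in>UNIV. if v \<in> S then Suc M else e v)"
    unfolding bounded_exps_def by (subst card_PiE) (auto intro!: prod.cong)
  also have "\<dots> = (\<Prod>v\<in>S. Suc M) * (\<Prod>v\<in>-S. e v)"
    by (subst prod.If_cases) (auto simp: Compl_eq)
  finally show ?thesis by simp
qed

lemma bounded_expsI:
  "(\<And>v. v \<in> S \<Longrightarrow> \<gamma> v \<le> M) \<Longrightarrow> (\<And>v. v \<notin> S \<Longrightarrow> \<gamma> v < e v) \<Longrightarrow> \<gamma> \<in> bounded_exps S e M"
  unfolding bounded_exps_def by auto

lemma bounded_expsD: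
  "\<gamma> \<in> bounded_exps S e M \<Longrightarrow> v \<in> S \<Longrightarrow> \<gamma> v \<le> M"
  "\<gamma> \<in> bounded_exps S e M \<Longrightarrow> v \<notin> S \<Longrightarrow> \<gamma> v < e v"
  unfolding bounded_exps_def PiE_iff by (auto split: if_splits dest: spec[of _ v])

lemma monomial_upd: "monomial (\<gamma>(v := n)) x = x v ^ n * monomial (\<gamma>(v := 0)) x"
  unfolding monomial_def by (simp add: prod.remove[of UNIV v])

lemma monomial_split: "monomial \<gamma> x = x v ^ \<gamma> v * monomial (\<gamma>(v := 0)) x"
  using monomial_upd[of \<gamma> v "\<gamma> v" x] by simp

lemma monomial_span_cong:
  "g \<in> monomial_span Z S e M \<Longrightarrow> (\<And>x. x \<in> Z \<Longrightarrow> h x = g x) \<Longrightarrow> h \<in> monomial_span Z S e M"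
  unfolding monomial_span_def by auto

lemma monomial_span_add:
  assumes "g \<in> monomial_span Z S e M" "h \<in> monomial_span Z S e M"
  shows "(\<lambda>x. g x + h x) \<in> monomial_span Z S e M"
proof -
  obtain a b where "\<forall>x\<in>Z. g x = (\<Sum>\<gamma>\<in>bounded_exps S e M. a \<gamma> * monomial \<gamma> x)"
    "\<forall>x\<in>Z. h x = (\<Sum>\<gamma>\<in>bounded_exps S e M. b \<gamma> * monomial \<gamma> x)"
    using assms unfolding monomial_span_def by blast
  then show ?thesis
    unfolding monomial_span_def
    by (auto intro!: exI[of _ "\<lambda>\<gamma>. a \<gamma> + b \<gamma>"] simp: distrib_right sum.distrib)
qed

lemma monomial_span_smult:
  assumes "g \<in> monomial_span Z S e M"
  shows "(\<lambda>x. c * g x) \<in> monomial_span Z S e M"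
proof -
  obtain a where "\<forall>x\<in>Z. g x = (\<Sum>\<gamma>\<in>bounded_exps S e M. a \<gamma> * monomial \<gamma> x)"
    using assms unfolding monomial_span_def by blast
  then show ?thesis
    unfolding monomial_span_def
    by (auto intro!: exI[of _ "\<lambda>\<gamma>. c * a \<gamma>"] simp: mult.assoc sum_distrib_left)
qed

lemma monomial_span_monomial:
  assumes "\<gamma> \<in> bounded_exps S e M"
  shows "monomial \<gamma> \<in> monomial_span Z S e M"
  unfolding monomial_span_def using assms
  by (auto intro!: exI[of _ "\<lambda>\<delta>. if \<delta> = \<gamma> then 1 else 0"]
      simp: if_distrib[of "\<lambda>c. c * _"] finite_bounded_exps cong: if_cong)

lemma monomial_span_zero: "(\<lambda>x. 0) \<in> monomial_span Z S e M"
  unfolding monomial_span_def by (auto intro!: exI[of _ "\<lambda>_. 0"])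

lemma monomial_span_sum:
  "(\<And>i. i \<in> I \<Longrightarrow> g i \<in> monomial_span Z S e M) \<Longrightarrow>
    (\<lambda>x. \<Sum>i\<in>I. g i x) \<in> monomial_span Z S e M"
  by (induction I rule: infinite_finite_induct) (auto simp: monomial_span_zero monomial_span_add)

lemma monomial_span_mult:
  assumes "\<And>\<gamma>. \<gamma> \<in> bounded_exps S e M \<Longrightarrow> (\<lambda>x. f x * monomial \<gamma> x) \<in> monomial_span Z S e N"
    and "g \<in> monomial_span Z S e M"
  shows "(\<lambda>x. f x * g x) \<in> monomial_span Z S e N"
proof -
  obtain a where a: "\<forall>x\<in>Z. g x = (\<Sum>\<gamma>\<in>bounded_exps S e M. a \<gamma> * monomial \<gamma> x)"
    using assms(2) unfolding monomial_span_def by blast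
  have "(\<lambda>x. \<Sum>\<gamma>\<in>bounded_exps S e M. a \<gamma> * (f x * monomial \<gamma> x)) \<in> monomial_span Z S e N"
    by (intro monomial_span_sum monomial_span_smult assms(1))
  then show ?thesis
    by (rule monomial_span_cong) (simp add: a sum_distrib_left mult_ac)
qed

lemma monomial_span_mono:
  assumes "M \<le> N" "g \<in> monomial_span Z S e M"
  shows "g \<in> monomial_span Z S e N"
proof -
  have "monomial \<gamma> \<in> monomial_span Z S e N" if "\<gamma> \<in> bounded_exps S e M" for \<gamma>
    by (intro monomial_span_monomial bounded_expsI)
      (use bounded_expsD[OF that] assms(1) in \<open>auto intro: order_trans\<close>)
  then show ?thesis
    using monomial_span_mult[of S e M "\<lambda>_. 1" Z N g] assms(2) by simp
qed

lemma span_shiftI: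
  "(\<And>M \<gamma>. \<gamma> \<in> bounded_exps S e M \<Longrightarrow> (\<lambda>x. f x * monomial \<gamma> x) \<in> monomial_span Z S e (M + c)) \<Longrightarrow>
    span_shift Z S e f c"
  unfolding span_shift_def by (rule allI, rule ballI, rule monomial_span_mult)

lemma span_shiftD:
  "span_shift Z S e f c \<Longrightarrow> g \<in> monomial_span Z S e M \<Longrightarrow> M + c \<le> N \<Longrightarrow>
    (\<lambda>x. f x * g x) \<in> monomial_span Z S e N"
  unfolding span_shift_def using monomial_span_mono by blast

lemma span_shift_mono: "c \<le> d \<Longrightarrow> span_shift Z S e f c \<Longrightarrow> span_shift Z S e f d"
  using span_shiftD[of Z S e f c] unfolding span_shift_def[of _ _ _ _ d] by simp

lemma span_shift_const: "span_shift Z S e (\<lambda>_. a) 0"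
  unfolding span_shift_def by (simp add: monomial_span_smult)

lemma span_shift_add:
  assumes "span_shift Z S e f c" "span_shift Z S e g d"
  shows "span_shift Z S e (\<lambda>x. f x + g x) (max c d)"
  unfolding span_shift_def distrib_right
  by (intro allI ballI monomial_span_add span_shiftD[OF assms(1)] span_shiftD[OF assms(2)]) auto

lemma span_shift_mult:
  assumes "span_shift Z S e f c" "span_shift Z S e g d"
  shows "span_shift Z S e (\<lambda>x. f x * g x) (c + d)"
  unfolding span_shift_def mult.assoc
proof (intro allI ballI)
  fix M h assume "h \<in> monomial_span Z S e M"
  then have "(\<lambda>x. g x * h x) \<in> monomial_span Z S e (M + d)"
    by (rule span_shiftD[OF assms(2)]) simp
  then show "(\<lambda>x. f x * (g x * h x)) \<in> monomial_span Z S e (M + (c + d))"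
    by (rule span_shiftD[OF assms(1)]) simp
qed

lemma span_shift_power:
  assumes "span_shift Z S e f c"
  shows "span_shift Z S e (\<lambda>x. f x ^ n) (n * c)"
proof (induction n)
  case 0
  then show ?case using span_shift_const[of Z S e 1] by simp
next
  case (Suc n)
  then show ?case using span_shift_mult[OF assms Suc] by simp
qed

lemma span_shift_prod:
  assumes "\<And>i. i \<in> I \<Longrightarrow> span_shift Z S e (f i) c"
  shows "span_shift Z S e (\<lambda>x. \<Prod>i\<in>I. f i x) (card I * c)"
  using assms
proof (induction I rule: infinite_finite_induct)
  case (insert i I)
  then have "span_shift Z S e (\<lambda>x. f i x * (\<Prod>i\<in>I. f i x)) (c + card I * c)"
    by (intro span_shift_mult) auto
  with insert show ?case by simp
qed (use span_shift_const[of Z S e 1] in auto)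

lemma span_shift_var:
  assumes "v \<in> S"
  shows "span_shift Z S e (\<lambda>x. x v) 1"
proof (rule span_shiftI)
  fix M \<gamma> assume \<gamma>: "\<gamma> \<in> bounded_exps S e M"
  have "\<gamma>(v := Suc (\<gamma> v)) \<in> bounded_exps S e (M + 1)"
    by (intro bounded_expsI)
      (use bounded_expsD[OF \<gamma>] assms in \<open>auto intro: order_trans le_SucI\<close>)
  then have "monomial (\<gamma>(v := Suc (\<gamma> v))) \<in> monomial_span Z S e (M + 1)"
    by (rule monomial_span_monomial)
  then show "(\<lambda>x. x v * monomial \<gamma> x) \<in> monomial_span Z S e (M + 1)"
    by (rule monomial_span_cong)
      (simp add: monomial_upd[of \<gamma> v "Suc (\<gamma> v)"] monomial_split[of \<gamma> _ v] mult_ac)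
qed

lemma span_shift_poly_funs: "f \<in> poly_funs S \<Longrightarrow> \<exists>c. span_shift Z S e f c"
proof (induction rule: poly_funs.induct)
  case (const c)
  show ?case by (rule exI, rule span_shift_const)
next
  case (var v)
  show ?case by (rule exI, rule span_shift_var[OF var])
next
  case (add f g)
  then show ?case by (elim exE) (rule exI, rule span_shift_add)
next
  case (mult f g)
  then show ?case by (elim exE) (rule exI, rule span_shift_mult)
qed

text \<open>An exponent of \<open>v\<close> that would reach \<open>e v\<close> is lowered by the relation. This introduces only
  coefficients from \<open>poly_funs S\<close>, at the price of the factor \<open>c (e v)\<close>.\<close>
lemma span_shift_algebraic:
  assumes v: "v \<notin> S" and c: "\<And>i. c i \<in> poly_funs S"
    and rel: "\<And>x. x \<in> Z \<Longrightarrow> (\<Sum>i\<le>e v. c i x * x v ^ i) = 0"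
  shows "\<exists>d. span_shift Z S e (\<lambda>x. c (e v) x * x v) d"
proof -
  have "\<forall>i. \<exists>d. span_shift Z S e (c i) d" using span_shift_poly_funs[OF c] by blast
  then obtain d where d: "\<And>i. span_shift Z S e (c i) (d i)" by metis
  define K where "K = (\<Sum>i\<le>e v. d i)"
  have cK: "span_shift Z S e (c i) K" if "i \<le> e v" for i
    using that member_le_sum[of i "{..e v}" d] unfolding K_def
    by (intro span_shift_mono[OF _ d]) auto
  have "(\<lambda>x. c (e v) x * x v * monomial \<gamma> x) \<in> monomial_span Z S e (M + K)"
    if \<gamma>: "\<gamma> \<in> bounded_exps S e M" for \<gamma> M
  proof -
    have upd: "(\<lambda>x. c i x * monomial (\<gamma>(v := n)) x) \<in> monomial_span Z S e (M + K)"
      if "n < e v" "i \<le> e v" for n i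
    proof -
      have "\<gamma>(v := n) \<in> bounded_exps S e M"
        by (intro bounded_expsI) (use bounded_expsD[OF \<gamma>] that v in auto)
      then show ?thesis
        by (intro span_shiftD[OF cK[OF that(2)]] monomial_span_monomial) auto
    qed
    show ?thesis
    proof (cases "Suc (\<gamma> v) < e v")
      case True
      then show ?thesis
        by (intro monomial_span_cong[OF upd[OF True order_refl]])
          (simp add: monomial_upd[of \<gamma> v "Suc (\<gamma> v)"] monomial_split[of \<gamma> _ v] mult_ac)
    next
      case False
      with bounded_expsD(2)[OF \<gamma> v] have ev: "e v = Suc (\<gamma> v)" by simp
      have "(\<lambda>x. \<Sum>i<e v. - 1 * (c i x * monomial (\<gamma>(v := i)) x)) \<in> monomial_span Z S e (M + K)"
        by (intro monomial_span_sum monomial_span_smult upd) auto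
      then show ?thesis
      proof (rule monomial_span_cong)
        fix x assume "x \<in> Z"
        then have lead: "c (e v) x * x v ^ e v = - (\<Sum>i<e v. c i x * x v ^ i)"
          using rel[of x] by (simp add: lessThan_Suc_atMost[symmetric] add_eq_0_iff)
        have "c (e v) x * x v * monomial \<gamma> x = (c (e v) x * x v ^ e v) * monomial (\<gamma>(v := 0)) x"
          by (simp add: ev monomial_split[of \<gamma> _ v] mult_ac)
        also have "\<dots> = (\<Sum>i<e v. - 1 * (c i x * (x v ^ i * monomial (\<gamma>(v := 0)) x)))"
          unfolding lead by (simp add: sum_distrib_right sum_negf mult.assoc)
        finally show "c (e v) x * x v * monomial \<gamma> x =
            (\<Sum>i<e v. - 1 * (c i x * monomial (\<gamma>(v := i)) x))"
          by (simp only: monomial_upd[of \<gamma> v, symmetric])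
      qed
    qed
  qed
  then have "span_shift Z S e (\<lambda>x. c (e v) x * x v) K"
    by (rule span_shiftI)
  then show ?thesis by blast
qed

lemma irreducible_on_prod:
  fixes Z :: "('v \<Rightarrow> 'a::idom) set"
  assumes "irreducible_on T Z" "finite I"
    "\<And>i. i \<in> I \<Longrightarrow> f i \<in> poly_funs T" "\<And>i. i \<in> I \<Longrightarrow> \<exists>x\<in>Z. f i x \<noteq> 0"
  shows "\<exists>x\<in>Z. (\<Prod>i\<in>I. f i x) \<noteq> 0"
  using assms(2-)
proof (induction I rule: finite_induct)
  case empty
  then show ?case using irreducible_on_nonempty[OF assms(1)] by auto
next
  case (insert i I)
  have "f i \<in> poly_funs T" "(\<lambda>x. \<Prod>i\<in>I. f i x) \<in> poly_funs T"
    using insert.prems(1) by (auto intro: poly_funs_prod)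
  from irreducible_onD[OF assms(1) this] insert.prems(2)[of i] insert.IH insert.prems
  have "\<exists>x\<in>Z. f i x * (\<Prod>i\<in>I. f i x) \<noteq> 0" by blast
  with insert.hyps show ?case by simp
qed

text \<open>After multiplication by a suitable power of a common denominator \<open>D\<close>, all products of powers of the
  \<open>f i\<close> with exponents up to \<open>M\<close> lie in a space of dimension of order \<open>M ^ card S\<close>, but there are
  \<open>Suc M ^ m\<close> of them. For large \<open>M\<close> they are linearly dependent on \<open>Z\<close>, and irreducibility
  allows the power of \<open>D\<close> to be cancelled.\<close>
lemma algebraic_dependence:
  fixes Z :: "('v::finite \<Rightarrow> 'a::field) set"
  assumes Z: "irreducible_on UNIV Z"
    and alg: "\<And>v. v \<notin> S \<Longrightarrow> algebraic_over Z S v"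
    and f: "\<And>i. i < m \<Longrightarrow> f i \<in> poly_funs UNIV" and m: "card S < m"
  shows "\<exists>M a. (\<exists>\<alpha>\<in>{..<m} \<rightarrow>\<^sub>E {..M}. a \<alpha> \<noteq> 0) \<and>
    (\<forall>x\<in>Z. (\<Sum>\<alpha>\<in>{..<m} \<rightarrow>\<^sub>E {..M}. a \<alpha> * (\<Prod>i<m. f i x ^ \<alpha> i)) = 0)"
proof -
  have "\<forall>v. \<exists>e c. v \<notin> S \<longrightarrow> ((\<forall>i. c i \<in> poly_funs S) \<and>
    (\<forall>x\<in>Z. (\<Sum>i\<le>e. c i x * x v ^ i) = 0) \<and> (\<exists>x\<in>Z. c e x \<noteq> 0))"
    using alg unfolding algebraic_over_def by simp
  then obtain e where "\<forall>v. \<exists>c. v \<notin> S \<longrightarrow> ((\<forall>i. c i \<in> poly_funs S) \<and>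
    (\<forall>x\<in>Z. (\<Sum>i\<le>e v. c i x * x v ^ i) = 0) \<and> (\<exists>x\<in>Z. c (e v) x \<noteq> 0))"
    by (rule choice[THEN exE])
  then obtain c where "\<forall>v. v \<notin> S \<longrightarrow> ((\<forall>i. c v i \<in> poly_funs S) \<and>
    (\<forall>x\<in>Z. (\<Sum>i\<le>e v. c v i x * x v ^ i) = 0) \<and> (\<exists>x\<in>Z. c v (e v) x \<noteq> 0))"
    by (rule choice[THEN exE])
  then have c: "\<And>v i. v \<notin> S \<Longrightarrow> c v i \<in> poly_funs S"
    "\<And>v x. v \<notin> S \<Longrightarrow> x \<in> Z \<Longrightarrow> (\<Sum>i\<le>e v. c v i x * x v ^ i) = 0"
    "\<And>v. v \<notin> S \<Longrightarrow> \<exists>x\<in>Z. c v (e v) x \<noteq> 0" by simp_all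
  have e: "e v > 0" if "v \<notin> S" for v
    using c(2,3)[OF that] by (cases "e v") auto
  \<comment> \<open>the product of all leading coefficients: multiplying by \<open>D\<close> allows any coordinate to be reduced\<close>
  define D where "D x = (\<Prod>v\<in>-S. c v (e v) x)" for x
  have D: "D \<in> poly_funs S" unfolding D_def by (intro poly_funs_prod c) simp
  have D0: "\<exists>x\<in>Z. D x \<noteq> 0"
    unfolding D_def
  proof (rule irreducible_on_prod[OF Z])
    fix v assume "v \<in> - S"
    then show "c v (e v) \<in> poly_funs UNIV" "\<exists>x\<in>Z. c v (e v) x \<noteq> 0"
      using poly_funs_mono[OF subset_UNIV c(1)[of v "e v"]] c(3)[of v] by simp_all
  qed simp
  have ex_shift: "\<exists>k c. span_shift Z S e (\<lambda>x. D x ^ k * g x) c" if "g \<in> poly_funs UNIV" for g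
    using that
  proof (induction rule: poly_funs.induct)
    case (const c)
    show ?case using span_shift_const[of Z S e c] by (intro exI[of _ 0]) auto
  next
    case (var v)
    show ?case
    proof (cases "v \<in> S")
      case True
      then show ?thesis using span_shift_var[of v S Z e] by (intro exI[of _ 0] exI[of _ 1]) simp
    next
      case False
      have D': "D x = (\<Prod>u\<in>-S-{v}. c u (e u) x) * c v (e v) x" for x
        unfolding D_def using False by (simp add: prod.remove[of "-S" v] mult.commute)
      have "(\<lambda>x. \<Prod>u\<in>-S-{v}. c u (e u) x) \<in> poly_funs S"
        by (intro poly_funs_prod c) simp
      then obtain c1 where c1: "span_shift Z S e (\<lambda>x. \<Prod>u\<in>-S-{v}. c u (e u) x) c1"
        using span_shift_poly_funs by blast
      obtain c2 where c2: "span_shift Z S e (\<lambda>x. c v (e v) x * x v) c2"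
        using span_shift_algebraic[of v S "c v" Z e] c False by blast
      from span_shift_mult[OF c1 c2] show ?thesis
        by (intro exI[of _ 1] exI[of _ "c1 + c2"]) (simp add: D' mult.assoc)
    qed
  next
    case (add f g)
    then obtain k c k' c' where *: "span_shift Z S e (\<lambda>x. D x ^ k * f x) c"
      "span_shift Z S e (\<lambda>x. D x ^ k' * g x) c'" by blast
    have "\<exists>d. span_shift Z S e (\<lambda>x. D x ^ j) d" for j
      by (intro span_shift_poly_funs poly_funs_power D)
    then obtain d d' where "span_shift Z S e (\<lambda>x. D x ^ k') d" "span_shift Z S e (\<lambda>x. D x ^ k) d'"
      by blast
    from span_shift_add[OF span_shift_mult[OF this(1) *(1)] span_shift_mult[OF this(2) *(2)]]
    have "span_shift Z S e (\<lambda>x. D x ^ (k + k') * (f x + g x)) (max (d + c) (d' + c'))"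
      by (simp add: algebra_simps power_add)
    then show ?case by blast
  next
    case (mult f g)
    then obtain k c k' c' where "span_shift Z S e (\<lambda>x. D x ^ k * f x) c"
      "span_shift Z S e (\<lambda>x. D x ^ k' * g x) c'" by blast
    from span_shift_mult[OF this]
    have "span_shift Z S e (\<lambda>x. D x ^ (k + k') * (f x * g x)) (c + c')"
      by (simp add: mult_ac power_add)
    then show ?case by blast
  qed
  have "\<forall>i. \<exists>k. i < m \<longrightarrow> (\<exists>c. span_shift Z S e (\<lambda>x. D x ^ k * f i x) c)"
    using ex_shift f by blast
  then obtain k where k: "\<And>i. i < m \<Longrightarrow> \<exists>c. span_shift Z S e (\<lambda>x. D x ^ k i * f i x) c" by metis
  \<comment> \<open>one power of \<open>D\<close> that clears the denominators of all \<open>f i\<close>\<close>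
  define E where "E x = D x ^ (\<Sum>i<m. k i)" for x
  have E: "E \<in> poly_funs S" unfolding E_def by (intro poly_funs_power D)
  have "\<exists>c. span_shift Z S e (\<lambda>x. E x * f i x) c" if i: "i < m" for i
  proof -
    obtain c1 where c1: "span_shift Z S e (\<lambda>x. D x ^ k i * f i x) c1" using k[OF i] by blast
    obtain c2 where c2: "span_shift Z S e (\<lambda>x. D x ^ (\<Sum>j\<in>{..<m}-{i}. k j)) c2"
      using span_shift_poly_funs[OF poly_funs_power[OF D]] by blast
    have "E x = D x ^ (\<Sum>j\<in>{..<m}-{i}. k j) * D x ^ k i" for x
      unfolding E_def using i by (simp add: sum.remove[of _ i] power_add mult.commute)
    with span_shift_mult[OF c2 c1] show ?thesis by (auto simp: mult.assoc)
  qed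
  then have "\<forall>i. \<exists>c. i < m \<longrightarrow> span_shift Z S e (\<lambda>x. E x * f i x) c" by blast
  then obtain d where d: "\<And>i. i < m \<Longrightarrow> span_shift Z S e (\<lambda>x. E x * f i x) (d i)" by metis
  obtain d' where d': "span_shift Z S e E d'" using span_shift_poly_funs[OF E] by blast
  define C where "C = d' + (\<Sum>i<m. d i)"
  have Ef: "span_shift Z S e (\<lambda>x. E x * f i x) C" if "i < m" for i
    using that member_le_sum[of i "{..<m}" d] by (intro span_shift_mono[OF _ d]) (auto simp: C_def)
  have EC: "span_shift Z S e E C" by (rule span_shift_mono[OF _ d']) (simp add: C_def)
  \<comment> \<open>large enough for the \<open>Suc M ^ m\<close> products of powers to outnumber the
    \<open>Suc (m * (M * C)) ^ card S * (\<Prod>v\<in>-S. e v)\<close> spanning monomials\<close>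
  define M where "M = Suc (m * C) ^ card S * (\<Prod>v\<in>-S. e v)"
  define A where "A = ({..<m} \<rightarrow>\<^sub>E {..M})"
  define G where "G = bounded_exps S e (m * (M * C))"
  have span: "(\<lambda>x. E x ^ (m * M) * (\<Prod>i<m. f i x ^ \<alpha> i)) \<in> monomial_span Z S e (m * (M * C))"
    if \<alpha>: "\<alpha> \<in> A" for \<alpha>
  proof -
    have le: "\<alpha> i \<le> M" if "i < m" for i using \<alpha> that unfolding A_def by auto
    have "span_shift Z S e (\<lambda>x. (E x * f i x) ^ \<alpha> i * E x ^ (M - \<alpha> i)) (M * C)" if "i < m" for i
      using span_shift_mult[OF span_shift_power[OF Ef[OF that], of "\<alpha> i"]
          span_shift_power[OF EC, of "M - \<alpha> i"]] le[OF that]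
      by (simp flip: distrib_right)
    then have "span_shift Z S e (\<lambda>x. \<Prod>i<m. (E x * f i x) ^ \<alpha> i * E x ^ (M - \<alpha> i)) (m * (M * C))"
      using span_shift_prod[of "{..<m}" Z S e "\<lambda>i x. (E x * f i x) ^ \<alpha> i * E x ^ (M - \<alpha> i)" "M * C"]
      by simp
    moreover have "monomial (\<lambda>_. 0) \<in> monomial_span Z S e 0"
      by (intro monomial_span_monomial bounded_expsI e) auto
    ultimately have "(\<lambda>x. (\<Prod>i<m. (E x * f i x) ^ \<alpha> i * E x ^ (M - \<alpha> i)) * monomial (\<lambda>_. 0) x)
        \<in> monomial_span Z S e (m * (M * C))"
      by (rule span_shiftD) simp
    moreover have "(\<Prod>i<m. (E x * f i x) ^ \<alpha> i * E x ^ (M - \<alpha> i)) * monomial (\<lambda>_. 0) x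
        = E x ^ (m * M) * (\<Prod>i<m. f i x ^ \<alpha> i)" for x
    proof -
      have "(\<Prod>i<m. (E x * f i x) ^ \<alpha> i * E x ^ (M - \<alpha> i)) = (\<Prod>i<m. E x ^ M * f i x ^ \<alpha> i)"
      proof (rule prod.cong)
        fix i assume "i \<in> {..<m}"
        then have "E x ^ M = E x ^ \<alpha> i * E x ^ (M - \<alpha> i)"
          using le[of i] by (simp flip: power_add)
        then show "(E x * f i x) ^ \<alpha> i * E x ^ (M - \<alpha> i) = E x ^ M * f i x ^ \<alpha> i"
          by (simp add: power_mult_distrib mult_ac)
      qed simp
      then show ?thesis by (simp add: prod.distrib monomial_def power_mult mult.commute)
    qed
    ultimately show ?thesis by simp
  qed
  have "\<forall>\<alpha>. \<exists>b. \<alpha> \<in> A \<longrightarrow> (\<forall>x\<in>Z. E x ^ (m * M) * (\<Prod>i<m. f i x ^ \<alpha> i) =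
      (\<Sum>\<gamma>\<in>G. b \<gamma> * monomial \<gamma> x))"
    using span unfolding monomial_span_def G_def by blast
  then obtain b where b: "\<And>\<alpha> x. \<alpha> \<in> A \<Longrightarrow> x \<in> Z \<Longrightarrow>
      E x ^ (m * M) * (\<Prod>i<m. f i x ^ \<alpha> i) = (\<Sum>\<gamma>\<in>G. b \<alpha> \<gamma> * monomial \<gamma> x)"
    by metis
  have "card G < card A"
  proof -
    have "card G = Suc (m * (M * C)) ^ card S * (\<Prod>v\<in>-S. e v)"
      unfolding G_def by (rule card_bounded_exps)
    also have "\<dots> \<le> (Suc (m * C) * Suc M) ^ card S * (\<Prod>v\<in>-S. e v)"
      by (intro mult_right_mono power_mono) (auto simp: algebra_simps)
    also have "\<dots> = M * Suc M ^ card S"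
      unfolding power_mult_distrib by (subst (2) M_def) (simp only: mult_ac)
    also have "\<dots> < Suc M ^ Suc (card S)" by simp
    also have "\<dots> \<le> Suc M ^ m" using m by (intro power_increasing) auto
    also have "\<dots> = card A" by (simp add: A_def card_PiE)
    finally show ?thesis .
  qed
  moreover have "finite A" unfolding A_def by (intro finite_PiE) auto
  ultimately obtain a where a: "\<exists>\<alpha>\<in>A. a \<alpha> \<noteq> 0" "\<forall>\<gamma>\<in>G. (\<Sum>\<alpha>\<in>A. a \<alpha> * b \<alpha> \<gamma>) = 0"
    using homogeneous_system_solution[of G A b] finite_bounded_exps unfolding G_def by blast
  define R where "R x = (\<Sum>\<alpha>\<in>A. a \<alpha> * (\<Prod>i<m. f i x ^ \<alpha> i))" for x
  have "E x ^ (m * M) * R x = 0" if x: "x \<in> Z" for x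
  proof -
    have "E x ^ (m * M) * R x = (\<Sum>\<alpha>\<in>A. a \<alpha> * (E x ^ (m * M) * (\<Prod>i<m. f i x ^ \<alpha> i)))"
      by (simp add: R_def sum_distrib_left mult_ac)
    also have "\<dots> = (\<Sum>\<alpha>\<in>A. \<Sum>\<gamma>\<in>G. a \<alpha> * b \<alpha> \<gamma> * monomial \<gamma> x)"
      using b x by (simp add: sum_distrib_left mult.assoc)
    also have "\<dots> = (\<Sum>\<gamma>\<in>G. (\<Sum>\<alpha>\<in>A. a \<alpha> * b \<alpha> \<gamma>) * monomial \<gamma> x)"
      by (subst sum.swap) (simp add: sum_distrib_right)
    also have "\<dots> = 0" using a(2) by simp
    finally show ?thesis .
  qed
  moreover have "R \<in> poly_funs UNIV"
    unfolding R_def by (intro poly_funs_sum poly_funs.mult poly_funs.const poly_funs_prod poly_funs_power f) simp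
  moreover have "(\<lambda>x. E x ^ (m * M)) \<in> poly_funs UNIV"
    using poly_funs_mono[OF _ E] by (intro poly_funs_power) auto
  ultimately have "(\<forall>x\<in>Z. E x ^ (m * M) = 0) \<or> (\<forall>x\<in>Z. R x = 0)"
    by (intro irreducible_onD[OF Z]) auto
  moreover have "\<not> (\<forall>x\<in>Z. E x ^ (m * M) = 0)"
    using D0 by (auto simp: E_def)
  ultimately have "\<forall>x\<in>Z. R x = 0" by blast
  with a(1) show ?thesis unfolding R_def A_def by blast
qed

text \<open>A relation on \<open>W (Suc m)\<close> is expanded in powers of \<open>f m\<close>. Its lowest coefficient is a relation between
  the previous functions on \<open>W m\<close>, where \<open>f m\<close> vanishes, and is trivial by induction; the next
  coefficients follow after dividing by powers of \<open>f m\<close>, which does not vanish on the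
  irreducible set \<open>W (Suc m)\<close>.\<close>
lemma chain_functions_independent:
  fixes W :: "nat \<Rightarrow> ('v \<Rightarrow> 'a::idom) set"
  assumes W: "\<And>i. i \<le> m \<Longrightarrow> irreducible_on UNIV (W i)" "\<And>i. i < m \<Longrightarrow> W i \<subseteq> W (Suc i)"
    and f: "\<And>i. i < m \<Longrightarrow> f i \<in> poly_funs UNIV" "\<And>i x. i < m \<Longrightarrow> x \<in> W i \<Longrightarrow> f i x = 0"
      "\<And>i. i < m \<Longrightarrow> \<exists>x\<in>W (Suc i). f i x \<noteq> 0"
    and a: "\<And>x. x \<in> W m \<Longrightarrow> (\<Sum>\<alpha>\<in>{..<m} \<rightarrow>\<^sub>E {..M}. a \<alpha> * (\<Prod>i<m. f i x ^ \<alpha> i)) = 0"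
    and \<alpha>: "\<alpha> \<in> {..<m} \<rightarrow>\<^sub>E {..M}"
  shows "a \<alpha> = 0"
  using assms
proof (induction m arbitrary: a \<alpha>)
  case 0
  obtain x where "x \<in> W 0" using irreducible_on_nonempty[OF "0.prems"(1)[of 0]] by auto
  with "0.prems"(6)[of x] "0.prems"(7) show ?case by simp
next
  case (Suc m)
  define P where "P = ({..<m} \<rightarrow>\<^sub>E {..M})"
  define A where "A n x = (\<Sum>\<beta>\<in>P. a (\<beta>(m := n)) * (\<Prod>i<m. f i x ^ \<beta> i))" for n x
  have A: "A n \<in> poly_funs UNIV" for n
    unfolding A_def using Suc.prems(3)
    by (intro poly_funs_sum poly_funs.mult poly_funs.const poly_funs_prod poly_funs_power) simp
  have ins: "{..<Suc m} \<rightarrow>\<^sub>E {..M} = (\<lambda>(n, \<beta>). \<beta>(m := n)) ` ({..M} \<times> P)"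
    unfolding P_def lessThan_Suc by (rule PiE_insert_eq)
  have inj: "inj_on (\<lambda>(n, \<beta>). \<beta>(m := n)) ({..M} \<times> P)"
    unfolding P_def by (rule inj_combinator) simp
  have expand: "(\<Sum>\<alpha>\<in>{..<Suc m} \<rightarrow>\<^sub>E {..M}. a \<alpha> * (\<Prod>i<Suc m. f i x ^ \<alpha> i)) =
      (\<Sum>n\<le>M. A n x * f m x ^ n)" for x
  proof -
    have "(\<Sum>\<alpha>\<in>{..<Suc m} \<rightarrow>\<^sub>E {..M}. a \<alpha> * (\<Prod>i<Suc m. f i x ^ \<alpha> i)) =
        (\<Sum>(n, \<beta>)\<in>{..M} \<times> P. a (\<beta>(m := n)) * ((\<Prod>i<m. f i x ^ \<beta> i) * f m x ^ n))"
      unfolding ins by (subst sum.reindex[OF inj]) (auto intro!: sum.cong prod.cong)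
    also have "\<dots> = (\<Sum>n\<le>M. A n x * f m x ^ n)"
      unfolding A_def by (simp add: sum.cartesian_product[symmetric] sum_distrib_right mult.assoc)
    finally show ?thesis .
  qed
  have zero: "a (\<beta>(m := n)) = 0" if "n \<le> M" "\<beta> \<in> P" for n \<beta>
    using that
  proof (induction n arbitrary: \<beta> rule: less_induct)
    case (less n)
    \<comment> \<open>the relation with \<open>f m ^ n\<close> divided out: it still vanishes on \<open>W (Suc m)\<close>, and on \<open>W m\<close>
      only its term \<open>A n\<close> survives\<close>
    define R where "R x = (\<Sum>k\<in>{n..M}. A k x * f m x ^ (k - n))" for x
    have low: "A k x = 0" if "k < n" for k x
    proof -
      have "k \<le> M" using that less.prems(1) by simp
      then have "a (\<beta>(m := k)) = 0" if "\<beta> \<in> P" for \<beta>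
        using less.IH[OF \<open>k < n\<close> _ that] by blast
      then show ?thesis unfolding A_def by (intro sum.neutral ballI) (simp only: mult_zero_left)
    qed
    have "f m x ^ n * R x = 0" if "x \<in> W (Suc m)" for x
    proof -
      have "f m x ^ n * R x = (\<Sum>k\<in>{n..M}. A k x * f m x ^ k)"
        unfolding R_def sum_distrib_left by (intro sum.cong) (auto simp: mult_ac simp flip: power_add)
      also have "\<dots> = (\<Sum>k\<le>M. A k x * f m x ^ k)"
        using low by (intro sum.mono_neutral_left) auto
      also have "\<dots> = 0" using Suc.prems(6)[OF that] by (simp add: expand del: prod.lessThan_Suc)
      finally show ?thesis .
    qed
    moreover have "R \<in> poly_funs UNIV"
      unfolding R_def using Suc.prems(3) by (intro poly_funs_sum poly_funs.mult A poly_funs_power) simp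
    moreover have "(\<lambda>x. f m x ^ n) \<in> poly_funs UNIV"
      using Suc.prems(3) by (intro poly_funs_power) simp
    ultimately have "(\<forall>x\<in>W (Suc m). f m x ^ n = 0) \<or> (\<forall>x\<in>W (Suc m). R x = 0)"
      by (intro irreducible_onD[OF Suc.prems(1)]) auto
    moreover have "\<not> (\<forall>x\<in>W (Suc m). f m x ^ n = 0)"
      using Suc.prems(5)[of m] by auto
    ultimately have R0: "\<forall>x\<in>W (Suc m). R x = 0" by blast
    have An: "A n x = 0" if x: "x \<in> W m" for x
    proof -
      have "R x = (\<Sum>k\<in>{n}. A k x * f m x ^ (k - n))"
        unfolding R_def using less.prems(1) Suc.prems(4)[of m x] x
        by (intro sum.mono_neutral_right) auto
      moreover have "R x = 0" using R0 x Suc.prems(2)[of m] by auto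
      ultimately show ?thesis by simp
    qed
    show ?case
    proof (rule Suc.IH[where a = "\<lambda>\<beta>. a (\<beta>(m := n))"])
      show "(\<Sum>\<beta>\<in>{..<m} \<rightarrow>\<^sub>E {..M}. a (\<beta>(m := n)) * (\<Prod>i<m. f i x ^ \<beta> i)) = 0" if "x \<in> W m" for x
        using An[OF that] unfolding A_def P_def .
      show "\<beta> \<in> {..<m} \<rightarrow>\<^sub>E {..M}" using less.prems(2) unfolding P_def .
    qed (use Suc.prems(1-5) in simp_all)
  qed
  from Suc.prems(7) obtain n \<beta> where "n \<le> M" "\<beta> \<in> P" "\<alpha> = \<beta>(m := n)"
    unfolding ins by auto
  with zero show ?case by (simp only:)
qed

lemma chain_length_le:
  fixes Z :: "('v::finite \<Rightarrow> 'a::field) set"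
  assumes Z: "irreducible_on UNIV Z" and alg: "\<And>v. v \<notin> S \<Longrightarrow> algebraic_over Z S v"
    and W: "\<And>i. i \<le> m \<Longrightarrow> irreducible_on UNIV (W i)" "\<And>i. i \<le> m \<Longrightarrow> closure_on UNIV (W i) = W i"
      "\<And>i. i < m \<Longrightarrow> W i \<subset> W (Suc i)" "W m \<subseteq> Z"
  shows "m \<le> card S"
proof (rule ccontr)
  assume "\<not> m \<le> card S"
  then have m: "card S < m" by simp
  have "\<exists>f. f \<in> poly_funs UNIV \<and> (\<forall>x\<in>W i. f x = 0) \<and> (\<exists>x\<in>W (Suc i). f x \<noteq> 0)" if i: "i < m" for i
  proof -
    obtain x where x: "x \<in> W (Suc i)" "x \<notin> W i" using W(3)[OF i] by blast
    then have "x \<notin> closure_on UNIV (W i)" using W(2)[of i] i by simp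
    with x(1) show ?thesis unfolding closure_on_def by auto
  qed
  then have "\<forall>i. \<exists>f. i < m \<longrightarrow> f \<in> poly_funs UNIV \<and> (\<forall>x\<in>W i. f x = 0) \<and> (\<exists>x\<in>W (Suc i). f x \<noteq> 0)"
    by simp
  then obtain f where "\<forall>i. i < m \<longrightarrow> f i \<in> poly_funs UNIV \<and> (\<forall>x\<in>W i. f i x = 0) \<and>
      (\<exists>x\<in>W (Suc i). f i x \<noteq> 0)" by (rule choice[THEN exE])
  then have f: "\<And>i. i < m \<Longrightarrow> f i \<in> poly_funs UNIV" "\<And>i x. i < m \<Longrightarrow> x \<in> W i \<Longrightarrow> f i x = 0"
      "\<And>i. i < m \<Longrightarrow> \<exists>x\<in>W (Suc i). f i x \<noteq> 0" by simp_all
  have "\<exists>M a. (\<exists>\<alpha>\<in>{..<m} \<rightarrow>\<^sub>E {..M}. a \<alpha> \<noteq> 0) \<and>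
      (\<forall>x\<in>Z. (\<Sum>\<alpha>\<in>{..<m} \<rightarrow>\<^sub>E {..M}. a \<alpha> * (\<Prod>i<m. f i x ^ \<alpha> i)) = 0)"
    by (rule algebraic_dependence[OF Z _ _ m]; (rule alg | rule f(1)); assumption)
  then obtain M a where a: "\<exists>\<alpha>\<in>{..<m} \<rightarrow>\<^sub>E {..M}. a \<alpha> \<noteq> 0"
    "\<forall>x\<in>Z. (\<Sum>\<alpha>\<in>{..<m} \<rightarrow>\<^sub>E {..M}. a \<alpha> * (\<Prod>i<m. f i x ^ \<alpha> i)) = 0"
    by (elim exE conjE) (rule that)
  have "a \<alpha> = 0" if "\<alpha> \<in> {..<m} \<rightarrow>\<^sub>E {..M}" for \<alpha>
  proof (rule chain_functions_independent[where W = W and f = f and m = m and a = a and M = M and \<alpha> = \<alpha>])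
    show "W i \<subseteq> W (Suc i)" if "i < m" for i using W(3)[OF that] by blast
    show "(\<Sum>\<alpha>\<in>{..<m} \<rightarrow>\<^sub>E {..M}. a \<alpha> * (\<Prod>i<m. f i x ^ \<alpha> i)) = 0" if "x \<in> W m" for x
      using a(2) W(4) that by blast
  qed (fact W(1) f that)+
  with a(1) show False by blast
qed

section \<open>The Zariski topology in terms of polynomial functions\<close>
lemma poly_funs_eq_eval_mpoly:
  "f \<in> poly_funs UNIV \<longleftrightarrow> (\<exists>p. f = (\<lambda>x. eval_mpoly x p))"
proof
  assume "f \<in> poly_funs UNIV"
  then show "\<exists>p. f = (\<lambda>x. eval_mpoly x p)"
  proof (induction rule: poly_funs.induct)
    case (const c)
    show ?case by (rule exI[of _ "Poly_Mapping.single 0 c"]) simp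
  next
    case (var v)
    have "(\<lambda>x. x v) = (\<lambda>x. eval_mpoly x (Poly_Mapping.single (Poly_Mapping.single v 1) 1))"
      by (simp add: eval_monom_def)
    then show ?case by (rule exI)
  next
    case (add f g)
    then obtain p q where "f = (\<lambda>x. eval_mpoly x p)" "g = (\<lambda>x. eval_mpoly x q)" by blast
    then have "(\<lambda>x. f x + g x) = (\<lambda>x. eval_mpoly x (p + q))" by (simp add: eval_mpoly_add)
    then show ?case by (rule exI)
  next
    case (mult f g)
    then obtain p q where "f = (\<lambda>x. eval_mpoly x p)" "g = (\<lambda>x. eval_mpoly x q)" by blast
    then have "(\<lambda>x. f x * g x) = (\<lambda>x. eval_mpoly x (p * q))" by (simp add: eval_mpoly_mult)
    then show ?case by (rule exI)
  qed
next
  assume "\<exists>p. f = (\<lambda>x. eval_mpoly x p)"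
  then show "f \<in> poly_funs UNIV"
    unfolding eval_mpoly_def eval_monom_def
    by (auto intro!: poly_funs_sum poly_funs.mult poly_funs.const poly_funs_prod poly_funs_power poly_funs.var)
qed

lemma poly_funs_eval_mpoly: "(\<lambda>x. eval_mpoly x p) \<in> poly_funs UNIV"
  unfolding poly_funs_eq_eval_mpoly by (rule exI) (rule refl)

lemma ball_poly_funs: "(\<forall>f\<in>poly_funs UNIV. P f) \<longleftrightarrow> (\<forall>p. P (\<lambda>x. eval_mpoly x p))"
  unfolding Ball_def poly_funs_eq_eval_mpoly by auto

text \<open>Passing from vectors to functions makes it possible to use index sets such as \<open>'n + 'l\<close> and to
  modify single coordinates.\<close>
definition coords :: "('a ^ 'n) set \<Rightarrow> ('n \<Rightarrow> 'a) set" where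
  "coords X = vec_nth ` X"

lemma in_coords: "vec_nth x \<in> coords X \<longleftrightarrow> x \<in> X"
  unfolding coords_def by (auto simp: vec_nth_inject)

lemma coords_vimage: "coords {x. vec_nth x \<in> C} = C"
proof (intro equalityI subsetI)
  fix x assume "x \<in> C"
  then have "vec_lambda x \<in> {x. vec_nth x \<in> C}" by (simp add: vec_lambda_inverse)
  moreover have "x = vec_nth (vec_lambda x)" by (simp add: vec_lambda_inverse)
  ultimately show "x \<in> coords {x. vec_nth x \<in> C}" unfolding coords_def by (rule image_eqI[rotated])
qed (auto simp: coords_def)

lemma ball_coords: "(\<forall>x\<in>coords X. P x) \<longleftrightarrow> (\<forall>x\<in>X. P (vec_nth x))"
  unfolding coords_def by simp

lemma bex_coords: "(\<exists>x\<in>coords X. P x) \<longleftrightarrow> (\<exists>x\<in>X. P (vec_nth x))"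
  unfolding coords_def by simp

lemma coords_subset: "coords X \<subseteq> coords Y \<longleftrightarrow> X \<subseteq> Y"
  unfolding coords_def by (rule inj_image_subset_iff) (simp add: inj_def vec_nth_inject)

lemma coords_eq: "coords X = coords Y \<longleftrightarrow> X = Y"
  using coords_subset[of X Y] coords_subset[of Y X] by (simp add: set_eq_subset)

lemma zariski_closure:
  "zariski closure_of X = {x :: 'a::field ^ 'n::finite. vec_nth x \<in> closure_on UNIV (coords X)}"
    (is "_ = ?C")
proof (rule closure_of_unique)
  show "X \<subseteq> ?C"
    using closure_on_superset[of "coords X" UNIV] by (auto simp: in_coords subset_iff coords_def)
  have "?C = zero_locus {p. \<forall>x\<in>X. eval_mpoly (vec_nth x) p = 0}"
    unfolding zero_locus_def closure_on_def ball_coords ball_poly_funs by auto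
  then show "closedin zariski ?C" unfolding closedin_zariski by blast
  fix T :: "('a ^ 'n) set" assume T: "X \<subseteq> T" "closedin zariski T"
  then obtain F where F: "T = zero_locus F" unfolding closedin_zariski by blast
  show "?C \<subseteq> T"
  proof
    fix x assume x: "x \<in> ?C"
    have "eval_mpoly (vec_nth x) p = 0" if "p \<in> F" for p
    proof (rule closure_onD[OF _ poly_funs_eval_mpoly])
      show "vec_nth x \<in> closure_on UNIV (coords X)" using x by simp
      show "eval_mpoly z p = 0" if "z \<in> coords X" for z
        using that \<open>p \<in> F\<close> T(1) unfolding F coords_def zero_locus_def by auto
    qed
    then show "x \<in> T" unfolding F zero_locus_def by simp
  qed
qed

lemma coords_closure: "coords (zariski closure_of X) = closure_on UNIV (coords X)"
  for X :: "('a::field ^ 'n::finite) set"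
  unfolding zariski_closure by (rule coords_vimage)

lemma closedin_zariski_iff: "closedin zariski Z \<longleftrightarrow> closure_on UNIV (coords Z) = coords Z"
  for Z :: "('a::field ^ 'n::finite) set"
  unfolding coords_closure[symmetric] coords_eq by (simp add: closure_of_eq)

lemma irreducible_set_iff: "irreducible_set zariski Z \<longleftrightarrow> irreducible_on UNIV (coords Z)"
  for Z :: "('a::field ^ 'n::finite) set"
proof
  assume Z: "irreducible_set zariski Z"
  show "irreducible_on UNIV (coords Z)"
    unfolding irreducible_on_def
  proof (intro conjI ballI impI)
    show "coords Z \<noteq> {}" using Z unfolding irreducible_set_def coords_def by simp
    fix f g :: "('n \<Rightarrow> 'a) \<Rightarrow> 'a"
    assume "f \<in> poly_funs UNIV" "g \<in> poly_funs UNIV" and fg: "\<forall>x\<in>coords Z. f x * g x = 0"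
    then obtain p q where pq: "f = (\<lambda>x. eval_mpoly x p)" "g = (\<lambda>x. eval_mpoly x q)"
      unfolding poly_funs_eq_eval_mpoly by blast
    define A where "A r = zero_locus {r} \<inter> Z" for r
    have "closedin (subtopology zariski Z) (A r)" for r
      unfolding A_def closedin_subtopology closedin_zariski by blast
    moreover have "Z = A p \<union> A q"
      using fg unfolding A_def zero_locus_def pq ball_coords by auto
    ultimately have "A p = Z \<or> A q = Z" using Z unfolding irreducible_set_def by blast
    then show "(\<forall>x\<in>coords Z. f x = 0) \<or> (\<forall>x\<in>coords Z. g x = 0)"
      unfolding A_def zero_locus_def pq ball_coords by auto
  qed
next
  assume Z: "irreducible_on UNIV (coords Z)"
  show "irreducible_set zariski Z"
    unfolding irreducible_set_def
  proof (intro conjI allI impI)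
    show "Z \<noteq> {}" using irreducible_on_nonempty[OF Z] unfolding coords_def by simp
    fix A B assume "closedin (subtopology zariski Z) A" "closedin (subtopology zariski Z) B"
      and AB: "Z = A \<union> B"
    then obtain F G where FG: "A = zero_locus F \<inter> Z" "B = zero_locus G \<inter> Z"
      unfolding closedin_subtopology closedin_zariski by blast
    show "A = Z \<or> B = Z"
    proof (rule ccontr)
      assume "\<not> ?thesis"
      then obtain x y where xy: "x \<in> Z" "x \<notin> zero_locus F" "y \<in> Z" "y \<notin> zero_locus G"
        using FG by blast
      then obtain p q where pq: "p \<in> F" "eval_mpoly (vec_nth x) p \<noteq> 0"
        "q \<in> G" "eval_mpoly (vec_nth y) q \<noteq> 0"
        unfolding zero_locus_def by blast
      have "z \<in> zero_locus F \<or> z \<in> zero_locus G" if "z \<in> Z" for z using AB FG that by blast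
      then have "\<forall>z\<in>coords Z. eval_mpoly z p * eval_mpoly z q = 0"
        using pq(1,3) unfolding zero_locus_def ball_coords by auto
      from irreducible_onD[OF Z poly_funs_eval_mpoly poly_funs_eval_mpoly this] pq xy
      show False unfolding ball_coords by blast
    qed
  qed
qed

lemma irreducible_set_subtopology:
  "Z \<subseteq> Y \<Longrightarrow> irreducible_set (subtopology T Y) Z \<longleftrightarrow> irreducible_set T Z"
  unfolding irreducible_set_def by (simp add: subtopology_subtopology Int_absorb1)

text \<open>The chain provided by \<open>chain_of_independent\<close>, read in the Zariski topology of \<open>Y\<close>.\<close>
lemma krull_dim_ge_independent:
  fixes Y :: "('a::stable_root_field ^ 'n::finite) set"
  assumes "irreducible_on UNIV (coords Y)" "closedin zariski Y" "independent_on (coords Y) B"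
  shows "enat (card B) \<le> krull_dim (subtopology zariski Y)"
proof -
  have "closure_on UNIV (coords Y) = coords Y"
    using assms(2) by (simp add: closedin_zariski_iff)
  from chain_of_independent[OF finite assms(1) this assms(3)]
  obtain W where W: "\<forall>i\<le>card B. irreducible_on UNIV (W i) \<and> closure_on UNIV (W i) = W i"
    "\<forall>i<card B. W i \<subset> W (Suc i)" "W (card B) = coords Y"
    by (elim exE conjE) (rule that)
  define V :: "nat \<Rightarrow> ('a ^ 'n) set" where "V i = {x. vec_nth x \<in> W i}" for i
  have cV: "coords (V i) = W i" for i unfolding V_def by (rule coords_vimage)
  have sub: "W i \<subseteq> coords Y" if "i \<le> card B" for i
    using that
  proof (induction rule: inc_induct)
    case base
    then show ?case using W(3) by simp
  next
    case (step n)
    then show ?case using W(2) by blast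
  qed
  then have VY: "V i \<subseteq> Y" if "i \<le> card B" for i
    using that by (simp add: cV flip: coords_subset)
  have "closedin (subtopology zariski Y) (V i) \<and> irreducible_set (subtopology zariski Y) (V i)"
    if "i \<le> card B" for i
    using that W(1) VY
    by (simp add: closedin_closed_subtopology assms(2) closedin_zariski_iff[of "V i"] cV
        irreducible_set_subtopology irreducible_set_iff)
  moreover have "V i \<subset> V (Suc i)" if "i < card B" for i
    using W(2) that by (simp add: psubset_eq cV flip: coords_subset coords_eq)
  ultimately show ?thesis
    unfolding krull_dim_def by (intro Sup_upper CollectI exI[of _ "card B"] exI[of _ V]) auto
qed

lemma krull_dim_le_algebraic:
  fixes Y :: "('a::field ^ 'n::finite) set"
  assumes Y: "irreducible_on UNIV (coords Y)" "closedin zariski Y"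
    and alg: "\<And>v. v \<notin> S \<Longrightarrow> algebraic_over (coords Y) S v"
  shows "krull_dim (subtopology zariski Y) \<le> enat (card S)"
  unfolding krull_dim_def
proof (rule Sup_least)
  fix d assume "d \<in> {enat m |m. \<exists>Z. (\<forall>i\<le>m. closedin (subtopology zariski Y) (Z i) \<and>
    irreducible_set (subtopology zariski Y) (Z i)) \<and> (\<forall>i<m. Z i \<subset> Z (Suc i))}"
  then obtain m Z where d: "d = enat m"
    and Z: "\<forall>i\<le>m. closedin (subtopology zariski Y) (Z i) \<and> irreducible_set (subtopology zariski Y) (Z i)"
      "\<forall>i<m. Z i \<subset> Z (Suc i)"
    by blast
  have ZY: "closedin zariski (Z i) \<and> Z i \<subseteq> Y" if "i \<le> m" for i
    using Z(1) that by (simp add: closedin_closed_subtopology[OF Y(2)])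
  have "m \<le> card S"
  proof (rule chain_length_le[OF Y(1) alg, of m "\<lambda>i. coords (Z i)"])
    show "irreducible_on UNIV (coords (Z i))" if "i \<le> m" for i
      using Z(1) ZY that by (simp add: irreducible_set_subtopology irreducible_set_iff)
    show "closure_on UNIV (coords (Z i)) = coords (Z i)" if "i \<le> m" for i
      using ZY[OF that] by (simp add: closedin_zariski_iff)
    show "coords (Z i) \<subset> coords (Z (Suc i))" if "i < m" for i
      using Z(2) that by (simp add: psubset_eq coords_subset coords_eq)
    show "coords (Z m) \<subseteq> coords Y"
      using ZY[of m] by (simp add: coords_subset)
  qed simp
  then show "d \<le> enat (card S)" by (simp add: d)
qed

section \<open>Recoverability and dimension\<close>
lemma independent_on_empty:
  assumes "Z \<noteq> {}"
  shows "independent_on Z {}"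
  unfolding independent_on_def
proof (intro ballI impI allI)
  fix f x assume f: "f \<in> poly_funs {}" "\<forall>x\<in>Z. f x = 0"
  obtain z where "z \<in> Z" using assms by blast
  have "f x = f z" by (rule poly_funs_cong[OF f(1)]) simp
  with f(2) \<open>z \<in> Z\<close> show "f x = 0" by simp
qed

lemma independent_on_mono: "Y \<subseteq> Z \<Longrightarrow> independent_on Y B \<Longrightarrow> independent_on Z B"
  unfolding independent_on_def by (simp add: subset_iff)

lemma maximal_independent:
  fixes Z :: "('v::finite \<Rightarrow> 'a::comm_ring_1) set"
  assumes "Z \<noteq> {}"
  obtains B where "independent_on Z B" "\<And>v. v \<notin> B \<Longrightarrow> \<not> independent_on Z (insert v B)"
proof -
  obtain B where B: "independent_on Z B" "\<And>C. independent_on Z C \<Longrightarrow> card C \<le> card B"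
    using ex_has_greatest_nat[of "independent_on Z" "{}" card "Suc (CARD('v))"]
      independent_on_empty[OF assms] by (auto simp: card_mono less_Suc_eq_le)
  have "\<not> independent_on Z (insert v B)" if "v \<notin> B" for v
    using B(2)[of "insert v B"] that by auto
  with B(1) show thesis by (rule that)
qed

text \<open>What the necessity of \<open>s \<ge> d\<close> needs to know about the points of a model. For closed sets it is
  \<open>infinite_fibre\<close>, and it is inherited by projections, which covers explicit models.\<close>
definition infinite_generic_fibres :: "('v \<Rightarrow> 'a::comm_ring_1) set \<Rightarrow> bool" where
  "infinite_generic_fibres Z \<longleftrightarrow> (\<forall>S b. \<not> algebraic_over Z S b \<longrightarrow>
    (\<forall>g\<in>poly_funs UNIV. (\<exists>x\<in>Z. g x \<noteq> 0) \<longrightarrow>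
      (\<exists>y\<in>Z. g y \<noteq> 0 \<and> infinite {x\<in>Z. \<forall>s\<in>S. x s = y s})))"

lemma infinite_generic_fibresD:
  "infinite_generic_fibres Z \<Longrightarrow> \<not> algebraic_over Z S b \<Longrightarrow> g \<in> poly_funs UNIV \<Longrightarrow>
    \<exists>x\<in>Z. g x \<noteq> 0 \<Longrightarrow> \<exists>y\<in>Z. g y \<noteq> 0 \<and> infinite {x\<in>Z. \<forall>s\<in>S. x s = y s}"
  unfolding infinite_generic_fibres_def by (drule spec[of _ S], drule spec[of _ b]) simp

text \<open>A coordinate not algebraic over the recorded ones would give an infinite fibre through some point of
  \<open>X\<close> in the open set \<open>U\<close>. So all coordinates are algebraic over the recorded ones, also on the closure.\<close>
lemma dim_le_if_generically_recoverable:
  fixes X :: "('a::field ^ 'n::finite) set" and \<mu> :: "'a ^ 'n \<Rightarrow> 'a ^ 's::finite"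
  assumes X: "irreducible_on UNIV (coords X)" "infinite_generic_fibres (coords X)"
    and \<mu>: "coordinate_projection \<mu>" "generically_recoverable X \<mu>"
  shows "variety_dim X \<le> enat CARD('s)"
proof -
  let ?Y = "zariski closure_of X"
  obtain i :: "'s \<Rightarrow> 'n" where i: "inj i" "\<mu> = (\<lambda>x. \<chi> j. x $ i j)"
    using \<mu>(1) unfolding coordinate_projection_def by blast
  obtain U where U: "openin (subtopology zariski ?Y) U" "U \<noteq> {}"
    "\<forall>x\<in>X \<inter> U. recoverable_at X \<mu> x"
    using \<mu>(2) unfolding generically_recoverable_def by blast
  obtain F where F: "U = - zero_locus F \<inter> ?Y"
    using U(1) unfolding openin_subtopology openin_zariski by blast
  obtain u p where p: "u \<in> ?Y" "p \<in> F" "eval_mpoly (vec_nth u) p \<noteq> 0"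
    using U(2) unfolding F zero_locus_def by blast
  define S where "S = range i"
  have alg: "algebraic_over (coords X) S v" for v
  proof (rule ccontr)
    assume *: "\<not> algebraic_over (coords X) S v"
    have "\<exists>x\<in>coords X. eval_mpoly x p \<noteq> 0"
    proof (rule ccontr)
      assume "\<not> ?thesis"
      then have *: "eval_mpoly z p = 0" if "z \<in> coords X" for z using that by blast
      have "vec_nth u \<in> closure_on UNIV (coords X)" using p(1) unfolding zariski_closure by simp
      from closure_onD[OF this poly_funs_eval_mpoly *] p(3) show False by blast
    qed
    from infinite_generic_fibresD[OF X(2) * poly_funs_eval_mpoly this] obtain y where
      y: "y \<in> coords X" "eval_mpoly y p \<noteq> 0" "infinite {x\<in>coords X. \<forall>s\<in>S. x s = y s}"
      by blast
    obtain y' where y': "y' \<in> X" "y = vec_nth y'" using y(1) unfolding coords_def by blast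
    have "y' \<in> U"
      using y'(1) y(2) p(2) closure_of_subset[of X zariski]
      unfolding F y'(2) zero_locus_def by auto
    then have "finite {x \<in> X. \<mu> x = \<mu> y'}"
      using U(3) y'(1) unfolding recoverable_at_def by blast
    moreover have "{x\<in>coords X. \<forall>s\<in>S. x s = y s} \<subseteq> vec_nth ` {x \<in> X. \<mu> x = \<mu> y'}"
      unfolding coords_def i(2) S_def y'(2) by (auto simp: vec_eq_iff)
    ultimately show False using y(3) finite_subset by blast
  qed
  have "algebraic_over (coords ?Y) S v" for v
  proof -
    obtain e c where c: "\<forall>i. c i \<in> poly_funs S"
      "\<forall>x\<in>coords X. (\<Sum>i\<le>e. c i x * x v ^ i) = 0" "\<exists>x\<in>coords X. c e x \<noteq> 0"
      using alg[of v] unfolding algebraic_over_def by blast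
    have "(\<lambda>x. \<Sum>i\<le>e. c i x * x v ^ i) \<in> poly_funs UNIV"
      using c(1) poly_funs_mono[of S UNIV]
      by (intro poly_funs_sum poly_funs.mult poly_funs_power poly_funs.var) auto
    then have "\<forall>x\<in>coords ?Y. (\<Sum>i\<le>e. c i x * x v ^ i) = 0"
      using c(2) unfolding coords_closure by (simp add: vanish_closure_on)
    moreover have "\<exists>x\<in>coords ?Y. c e x \<noteq> 0"
      using c(3) closure_on_superset[of "coords X" UNIV] unfolding coords_closure by blast
    ultimately show ?thesis
      unfolding algebraic_over_def using c(1) by blast
  qed
  then have "krull_dim (subtopology zariski ?Y) \<le> enat (card S)"
    using irreducible_on_closure[OF X(1)]
    by (intro krull_dim_le_algebraic) (simp_all add: coords_closure)
  moreover have "card S = CARD('s)" unfolding S_def by (rule card_image[OF i(1)])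
  ultimately show ?thesis unfolding variety_dim_def by simp
qed

text \<open>Once the coordinates in \<open>B\<close> are fixed, every other coordinate is a root of a fixed nonzero
  polynomial.\<close>
lemma finite_fibre_of_relations:
  fixes Z :: "('v::finite \<Rightarrow> 'a::real_normed_field) set"
  assumes "\<And>v. v \<notin> B \<Longrightarrow> \<exists>n d. (\<forall>i. d i \<in> poly_funs B) \<and> (\<forall>y\<in>Z. (\<Sum>i<n. d i y * y v ^ i) = 0) \<and>
      (\<exists>i<n. d i x \<noteq> 0)"
  shows "finite {y\<in>Z. \<forall>v\<in>B. y v = x v}"
proof -
  have "\<exists>R. finite R \<and> (\<forall>y\<in>Z. (\<forall>v\<in>B. y v = x v) \<longrightarrow> y v \<in> R)" for v
  proof (cases "v \<in> B")
    case True
    then show ?thesis by (intro exI[of _ "{x v}"]) simp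
  next
    case False
    then obtain n d where d: "\<And>i. d i \<in> poly_funs B" "\<And>y. y \<in> Z \<Longrightarrow> (\<Sum>i<n. d i y * y v ^ i) = 0"
      "\<exists>i<n. d i x \<noteq> 0"
      using assms[OF False] by blast
    then obtain k where k: "n = Suc k" by (cases n) auto
    have "finite {t. (\<Sum>i\<le>k. d i x * t ^ i) = 0}"
      unfolding polyfun_finite_roots using d(3) unfolding k less_Suc_eq_le .
    moreover have "(\<Sum>i\<le>k. d i x * y v ^ i) = 0" if "y \<in> Z" "\<forall>v\<in>B. y v = x v" for y
    proof -
      have "d i y = d i x" for i using that(2) by (intro poly_funs_cong[OF d(1)]) simp
      then show ?thesis using d(2)[OF that(1)] by (simp add: k lessThan_Suc_atMost)
    qed
    ultimately show ?thesis
      by (intro exI[of _ "{t. (\<Sum>i\<le>k. d i x * t ^ i) = 0}"]) simp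
  qed
  then obtain R where R: "\<And>v. finite (R v)" "\<And>v y. y \<in> Z \<Longrightarrow> \<forall>v\<in>B. y v = x v \<Longrightarrow> y v \<in> R v"
    by metis
  have "{y\<in>Z. \<forall>v\<in>B. y v = x v} \<subseteq> (\<Pi>\<^sub>E v\<in>UNIV. R v)"
    using R(2) by auto
  then show ?thesis by (rule finite_subset) (intro finite_PiE R(1) finite)
qed

text \<open>By maximality of the independent set \<open>B\<close> each other coordinate satisfies a relation over \<open>B\<close> with some
  coefficient nonzero on \<open>X\<close>. The open set consists of the points where these coefficients do not vanish.\<close>
lemma generically_recoverable_if_dim_le:
  fixes X :: "('a::stable_root_field ^ 'n::finite) set"
  assumes X: "irreducible_on UNIV (coords X)"
    and dim: "variety_dim X \<le> enat CARD('s::finite)" "CARD('s) \<le> CARD('n)"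
  shows "\<exists>\<mu> :: 'a ^ 'n \<Rightarrow> 'a ^ 's. coordinate_projection \<mu> \<and> generically_recoverable X \<mu>"
proof -
  let ?Y = "zariski closure_of X"
  obtain B where B: "independent_on (coords X) B"
    "\<And>v. v \<notin> B \<Longrightarrow> \<not> independent_on (coords X) (insert v B)"
    using maximal_independent[OF irreducible_on_nonempty[OF X]] by blast
  have "independent_on (coords ?Y) B"
    unfolding coords_closure by (rule independent_on_mono[OF closure_on_superset B(1)])
  then have "enat (card B) \<le> variety_dim X"
    unfolding variety_dim_def using irreducible_on_closure[OF X]
    by (intro krull_dim_ge_independent) (simp_all add: coords_closure)
  from this dim(1) have "enat (card B) \<le> enat CARD('s)" by (rule order_trans)
  then have "card B \<le> CARD('s)" by simp
  then obtain S where S: "B \<subseteq> S" "card S = CARD('s)"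
    using exists_subset_between[of B "CARD('s)" "UNIV :: 'n set"] dim(2) by auto
  obtain i :: "'s \<Rightarrow> 'n" where i: "bij_betw i UNIV S"
    using finite_same_card_bij[of "UNIV :: 's set" S] S(2) by auto
  define \<mu> :: "'a ^ 'n \<Rightarrow> 'a ^ 's" where "\<mu> x = (\<chi> j. x $ i j)" for x
  have "\<exists>n d k. (\<forall>i. d i \<in> poly_funs B) \<and> (\<forall>y\<in>coords X. (\<Sum>i<n. d i y * y v ^ i) = 0) \<and>
      k < n \<and> (\<exists>x\<in>coords X. d k x \<noteq> 0)" if v: "v \<notin> B" for v
  proof -
    obtain f where f: "f \<in> poly_funs (insert v B)" "\<forall>x\<in>coords X. f x = 0" "\<exists>x. f x \<noteq> 0"
      using B(2)[OF v] unfolding independent_on_def by blast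
    obtain n d where d: "\<And>i. d i \<in> poly_funs B" "f = (\<lambda>x. \<Sum>i<n. d i x * x v ^ i)"
      using poly_funs_insert_expand[OF f(1)] by (elim exE poly_inE) blast
    have "\<exists>k<n. \<exists>x. d k x \<noteq> 0"
    proof (rule ccontr)
      assume "\<not> ?thesis"
      then have "f x = 0" for x unfolding d(2) by (intro sum.neutral) auto
      with f(3) show False by simp
    qed
    then obtain k where k: "k < n" "\<exists>x. d k x \<noteq> 0" by blast
    then have "\<exists>x\<in>coords X. d k x \<noteq> 0" using independent_onD[OF B(1) d(1)[of k]] by blast
    with d f(2) k(1) show ?thesis by blast
  qed
  then have "\<forall>v. \<exists>n d k. v \<notin> B \<longrightarrow> (\<forall>i. d i \<in> poly_funs B) \<and>
      (\<forall>y\<in>coords X. (\<Sum>i<n. d i y * y v ^ i) = 0) \<and> k < n \<and> (\<exists>x\<in>coords X. d (k) x \<noteq> 0)"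
    by simp
  then obtain n where "\<forall>v. \<exists>d k. v \<notin> B \<longrightarrow> (\<forall>i. d i \<in> poly_funs B) \<and>
      (\<forall>y\<in>coords X. (\<Sum>i<n v. d i y * y v ^ i) = 0) \<and> k < n v \<and> (\<exists>x\<in>coords X. d (k) x \<noteq> 0)"
    by (rule choice[THEN exE])
  then obtain d where "\<forall>v. \<exists>k. v \<notin> B \<longrightarrow> (\<forall>i. d v i \<in> poly_funs B) \<and>
      (\<forall>y\<in>coords X. (\<Sum>i<n v. d v i y * y v ^ i) = 0) \<and> k < n v \<and> (\<exists>x\<in>coords X. d v (k) x \<noteq> 0)"
    by (rule choice[THEN exE])
  then obtain k where "\<forall>v. v \<notin> B \<longrightarrow> (\<forall>i. d v i \<in> poly_funs B) \<and>
      (\<forall>y\<in>coords X. (\<Sum>i<n v. d v i y * y v ^ i) = 0) \<and> k v < n v \<and> (\<exists>x\<in>coords X. d v (k v) x \<noteq> 0)"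
    by (rule choice[THEN exE])
  then have d: "(\<forall>i. d v i \<in> poly_funs B) \<and>
      (\<forall>y\<in>coords X. (\<Sum>i<n v. d v i y * y v ^ i) = 0) \<and> k v < n v \<and> (\<exists>x\<in>coords X. d v (k v) x \<noteq> 0)"
    if "v \<notin> B" for v
    using that by (elim allE impE)
  \<comment> \<open>outside the zeros of \<open>G\<close> every relation stays nontrivial after fixing the coordinates in \<open>B\<close>\<close>
  define G where "G x = (\<Prod>v\<in>-B. d v (k v) x)" for x
  have "d v (k v) \<in> poly_funs UNIV" if "v \<in> - B" for v
    using d[of v] that by (intro poly_funs_mono[of B UNIV]) auto
  then have G: "G \<in> poly_funs UNIV" "\<exists>x\<in>coords X. G x \<noteq> 0"
    unfolding G_def using d by (intro poly_funs_prod irreducible_on_prod[OF X]; simp)+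
  then obtain p where p: "G = (\<lambda>x. eval_mpoly x p)" unfolding poly_funs_eq_eval_mpoly by blast
  define U where "U = - zero_locus {p} \<inter> ?Y"
  have "openin (subtopology zariski ?Y) U"
    unfolding U_def openin_subtopology openin_zariski by blast
  moreover have "U \<noteq> {}"
  proof -
    obtain x where "x \<in> X" "G (vec_nth x) \<noteq> 0" using G(2) unfolding bex_coords by blast
    moreover have "X \<subseteq> ?Y" by (rule closure_of_subset) simp
    ultimately show ?thesis unfolding U_def zero_locus_def p by auto
  qed
  moreover have "recoverable_at X \<mu> x" if x: "x \<in> X \<inter> U" for x
  proof -
    have "G (vec_nth x) \<noteq> 0" using x unfolding U_def zero_locus_def p by simp
    then have "d v (k v) (vec_nth x) \<noteq> 0" if "v \<notin> B" for v
      using that unfolding G_def by (simp add: prod_zero_iff)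
    then have "finite {y\<in>coords X. \<forall>v\<in>B. y v = x $ v}"
      using d by (intro finite_fibre_of_relations) blast
    moreover have "vec_nth ` {y \<in> X. \<mu> y = \<mu> x} \<subseteq> {y\<in>coords X. \<forall>v\<in>B. y v = x $ v}"
    proof (rule image_subsetI)
      fix y assume "y \<in> {y \<in> X. \<mu> y = \<mu> x}"
      then have y: "y \<in> X" "\<mu> y = \<mu> x" by simp_all
      have "y $ v = x $ v" if "v \<in> B" for v
      proof -
        have "v \<in> range i" using \<open>v \<in> B\<close> S(1) i unfolding bij_betw_def by blast
        then obtain j where "v = i j" by blast
        moreover have "y $ i j = x $ i j"
          using arg_cong[OF y(2), of "\<lambda>z. z $ j"] unfolding \<mu>_def by simp
        ultimately show ?thesis by simp
      qed
      then show "vec_nth y \<in> {y\<in>coords X. \<forall>v\<in>B. y v = x $ v}"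
        using y(1) by (simp add: in_coords)
    qed
    ultimately have "finite (vec_nth ` {y \<in> X. \<mu> y = \<mu> x})" by (rule finite_subset[rotated])
    then show ?thesis
      unfolding recoverable_at_def by (rule finite_imageD) (auto simp: inj_on_def vec_nth_inject)
  qed
  ultimately have "generically_recoverable X \<mu>"
    unfolding generically_recoverable_def by blast
  moreover have "coordinate_projection \<mu>"
    unfolding coordinate_projection_def \<mu>_def using i by (auto simp: bij_betw_def)
  ultimately show ?thesis by blast
qed

lemma infinite_generic_fibres_closed:
  fixes Z :: "('v::finite \<Rightarrow> 'a::stable_root_field) set"
  assumes "irreducible_on UNIV Z" "closure_on UNIV Z = Z"
  shows "infinite_generic_fibres Z"
  unfolding infinite_generic_fibres_def
proof (intro allI ballI impI)
  fix S b and g :: "('v \<Rightarrow> 'a) \<Rightarrow> 'a"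
  assume "\<not> algebraic_over Z S b" "g \<in> poly_funs UNIV" "\<exists>x\<in>Z. g x \<noteq> 0"
  from infinite_fibre[OF assms this] obtain y where
    "y \<in> Z" "g y \<noteq> 0" "infinite ((\<lambda>x. x b) ` {x\<in>Z. \<forall>s\<in>S. x s = y s})" by blast
  then show "\<exists>y\<in>Z. g y \<noteq> 0 \<and> infinite {x\<in>Z. \<forall>s\<in>S. x s = y s}"
    using finite_imageI by blast
qed

text \<open>Coordinates of \<open>\<Gamma>\<close> other than the projected ones are never among the fixed coordinates \<open>S\<close>. So
  non-algebraicity on the projection lifts to \<open>\<Gamma>\<close>, and the infinitely many values of \<open>x b\<close> found in a
  fibre of \<open>\<Gamma>\<close> are values on the projection.\<close>
lemma projection_of_closed:
  fixes \<Gamma> :: "('n::finite + 'l::finite \<Rightarrow> 'a::stable_root_field) set"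
  assumes \<Gamma>: "irreducible_on UNIV \<Gamma>" "closure_on UNIV \<Gamma> = \<Gamma>"
  defines "\<pi> \<equiv> \<lambda>x i. x (Inl i)"
  shows "irreducible_on UNIV (\<pi> ` \<Gamma>)" "infinite_generic_fibres (\<pi> ` \<Gamma>)"
proof -
  have pull: "(\<lambda>x. g (\<pi> x)) \<in> poly_funs UNIV" if "g \<in> poly_funs UNIV" for g
    unfolding \<pi>_def by (rule poly_funs_subst[OF that, of "\<lambda>i x. x (Inl i)"]) (rule poly_funs.var, simp)
  show "irreducible_on UNIV (\<pi> ` \<Gamma>)"
    unfolding irreducible_on_def
  proof (intro conjI ballI impI)
    show "\<pi> ` \<Gamma> \<noteq> {}" using irreducible_on_nonempty[OF \<Gamma>(1)] by simp
    fix f g assume fg: "f \<in> poly_funs UNIV" "g \<in> poly_funs UNIV" "\<forall>x\<in>\<pi> ` \<Gamma>. f x * g x = 0"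
    from irreducible_onD[OF \<Gamma>(1) pull[OF fg(1)] pull[OF fg(2)]] fg(3)
    show "(\<forall>x\<in>\<pi> ` \<Gamma>. f x = 0) \<or> (\<forall>x\<in>\<pi> ` \<Gamma>. g x = 0)" by simp
  qed
  show "infinite_generic_fibres (\<pi> ` \<Gamma>)"
    unfolding infinite_generic_fibres_def
  proof (intro allI ballI impI)
    fix S b and g :: "('n \<Rightarrow> 'a) \<Rightarrow> 'a"
    assume b: "\<not> algebraic_over (\<pi> ` \<Gamma>) S b" and g: "g \<in> poly_funs UNIV" "\<exists>x\<in>\<pi> ` \<Gamma>. g x \<noteq> 0"
    have "\<not> algebraic_over \<Gamma> (Inl ` S) (Inl b)"
    proof
      assume "algebraic_over \<Gamma> (Inl ` S) (Inl b)"
      then obtain e c where c: "\<And>i. c i \<in> poly_funs (Inl ` S)"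
        "\<forall>x\<in>\<Gamma>. (\<Sum>i\<le>e. c i x * x (Inl b) ^ i) = 0" "\<exists>x\<in>\<Gamma>. c e x \<noteq> 0"
        unfolding algebraic_over_def by blast
      \<comment> \<open>\<open>c i\<close> does not see the parameters, so they may be set to \<open>0\<close>\<close>
      define c' where "c' i x = c i (case_sum x (\<lambda>_. 0))" for i x
      have c': "c' i \<in> poly_funs S" for i
      proof -
        have "(\<lambda>x. case_sum x (\<lambda>_. 0) v) \<in> poly_funs S" if "v \<in> Inl ` S" for v
          using that by (elim imageE) (simp add: poly_funs.var)
        then have "(\<lambda>x. c i (\<lambda>v. case_sum x (\<lambda>_. 0) v)) \<in> poly_funs S"
          by (intro poly_funs_subst[OF c(1)])
        then show ?thesis unfolding c'_def .
      qed
      have eq: "c' i (\<pi> x) = c i x" for i x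
        unfolding c'_def \<pi>_def by (intro poly_funs_cong[OF c(1)]) auto
      have "algebraic_over (\<pi> ` \<Gamma>) S b"
        unfolding algebraic_over_def
      proof (intro exI conjI allI)
        show "c' i \<in> poly_funs S" for i by (rule c')
        show "\<forall>x\<in>\<pi> ` \<Gamma>. (\<Sum>i\<le>e. c' i x * x b ^ i) = 0" "\<exists>x\<in>\<pi> ` \<Gamma>. c' e x \<noteq> 0"
          using c(2,3) by (simp_all add: eq) (simp add: \<pi>_def)
      qed
      with b show False ..
    qed
    moreover have "\<exists>x\<in>\<Gamma>. g (\<pi> x) \<noteq> 0" using g(2) by blast
    ultimately obtain y where y: "y \<in> \<Gamma>" "g (\<pi> y) \<noteq> 0"
      "infinite ((\<lambda>x. x (Inl b)) ` {x\<in>\<Gamma>. \<forall>s\<in>Inl ` S. x s = y s})"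
      using infinite_fibre[OF \<Gamma> _ pull[OF g(1)]] by blast
    have "(\<lambda>x. x (Inl b)) ` {x\<in>\<Gamma>. \<forall>s\<in>Inl ` S. x s = y s} \<subseteq>
        (\<lambda>x. x b) ` {x\<in>\<pi> ` \<Gamma>. \<forall>s\<in>S. x s = \<pi> y s}"
    proof
      fix t assume "t \<in> (\<lambda>x. x (Inl b)) ` {x\<in>\<Gamma>. \<forall>s\<in>Inl ` S. x s = y s}"
      then obtain x where x: "x \<in> \<Gamma>" "\<forall>s\<in>S. x (Inl s) = y (Inl s)" "t = x (Inl b)" by blast
      then show "t \<in> (\<lambda>x. x b) ` {x\<in>\<pi> ` \<Gamma>. \<forall>s\<in>S. x s = \<pi> y s}"
        by (intro image_eqI[of _ _ "\<pi> x"]) (simp_all add: \<pi>_def)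
    qed
    then have "infinite {x\<in>\<pi> ` \<Gamma>. \<forall>s\<in>S. x s = \<pi> y s}"
      using y(3) by (meson finite_imageI finite_subset)
    with y show "\<exists>y\<in>\<pi> ` \<Gamma>. g y \<noteq> 0 \<and> infinite {x\<in>\<pi> ` \<Gamma>. \<forall>s\<in>S. x s = y s}" by blast
  qed
qed

text \<open>\<open>\<Gamma>\<close> is the graph of the parametrization. It is closed, being cut out by \<open>x\<^sub>i = \<phi>\<^sub>i(t)\<close>, and
  irreducible, since polynomial functions on it are polynomial functions of the parameters alone.\<close>
lemma explicit_model_is_projection:
  fixes X :: "('a::stable_root_field ^ 'n::finite) set"
  assumes "explicit_model TYPE('l::finite) X"
  obtains \<Gamma> :: "('n + 'l::finite \<Rightarrow> 'a) set" where "irreducible_on UNIV \<Gamma>" "closure_on UNIV \<Gamma> = \<Gamma>"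
    "coords X = (\<lambda>x i. x (Inl i)) ` \<Gamma>"
proof -
  obtain \<phi> :: "'n \<Rightarrow> ('l, 'a) mpoly" where
    X: "X = range (\<lambda>t :: 'a ^ 'l. \<chi> i. eval_mpoly (($) t) (\<phi> i))"
    using assms unfolding explicit_model_def by blast
  define \<gamma> :: "('l \<Rightarrow> 'a) \<Rightarrow> 'n + 'l \<Rightarrow> 'a" where "\<gamma> t = case_sum (\<lambda>i. eval_mpoly t (\<phi> i)) t" for t
  have pull: "(\<lambda>t. f (\<gamma> t)) \<in> poly_funs UNIV" if "f \<in> poly_funs UNIV" for f
  proof -
    have "(\<lambda>t. \<gamma> t v) \<in> poly_funs UNIV" for v
      by (cases v) (simp_all add: \<gamma>_def poly_funs_eval_mpoly poly_funs.var)
    then have "(\<lambda>t. f (\<lambda>v. \<gamma> t v)) \<in> poly_funs UNIV"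
      by (intro poly_funs_subst[OF that])
    then show ?thesis .
  qed
  show thesis
  proof (rule that[of "range \<gamma>"])
    show "irreducible_on UNIV (range \<gamma>)"
      unfolding irreducible_on_def
    proof (intro conjI ballI impI)
      fix f g assume fg: "f \<in> poly_funs UNIV" "g \<in> poly_funs UNIV" "\<forall>x\<in>range \<gamma>. f x * g x = 0"
      then have "f (\<gamma> t) * g (\<gamma> t) = 0" for t by blast
      from poly_funs_no_zero_divisors[OF pull[OF fg(1)] pull[OF fg(2)] this]
      show "(\<forall>x\<in>range \<gamma>. f x = 0) \<or> (\<forall>x\<in>range \<gamma>. g x = 0)" by blast
    qed simp
    show "closure_on UNIV (range \<gamma>) = range \<gamma>"
    proof (intro equalityI closure_on_superset subsetI)
      fix x assume x: "x \<in> closure_on UNIV (range \<gamma>)"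
      have "x (Inl i) - eval_mpoly (\<lambda>j. x (Inr j)) (\<phi> i) = 0" for i
      proof (rule closure_onD[OF x])
        have "(\<lambda>x. eval_mpoly (\<lambda>j. x (Inr j)) (\<phi> i)) \<in> poly_funs UNIV"
          by (rule poly_funs_subst[OF poly_funs_eval_mpoly, of "\<lambda>j x. x (Inr j)"])
            (rule poly_funs.var, simp)
        then show "(\<lambda>x. x (Inl i) - eval_mpoly (\<lambda>j. x (Inr j)) (\<phi> i)) \<in> poly_funs UNIV"
          by (intro poly_funs_diff poly_funs.var) simp_all
      qed (auto simp: \<gamma>_def)
      then have "x = \<gamma> (\<lambda>j. x (Inr j))"
        unfolding \<gamma>_def by (auto simp: fun_eq_iff split: sum.split)
      then show "x \<in> range \<gamma>" by (rule range_eqI[of x \<gamma>])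
    qed
    have "coords X = range (\<lambda>t i. eval_mpoly t (\<phi> i))"
    proof (intro equalityI subsetI)
      fix y assume "y \<in> range (\<lambda>t i. eval_mpoly t (\<phi> i))"
      then obtain t where "y = (\<lambda>i. eval_mpoly t (\<phi> i))" by blast
      then have "y = vec_nth (\<chi> i. eval_mpoly (($) (vec_lambda t)) (\<phi> i))"
        by (simp add: fun_eq_iff vec_lambda_inverse)
      then show "y \<in> coords X" unfolding coords_def X by blast
    qed (auto simp: coords_def X fun_eq_iff)
    then show "coords X = (\<lambda>x i. x (Inl i)) ` range \<gamma>"
      unfolding image_image \<gamma>_def by simp
  qed
qed

theorem generically_recoverable_iff_dim:
  fixes X :: "('a::stable_root_field ^ 'n::finite) set"
  assumes s: "CARD('s::finite) \<le> CARD('n)"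
    and X: "implicit_model X \<or> explicit_model TYPE('l::finite) X"
  shows "(\<exists>\<mu> :: 'a ^ 'n \<Rightarrow> 'a ^ 's. coordinate_projection \<mu> \<and> generically_recoverable X \<mu>) \<longleftrightarrow>
    enat CARD('s) \<ge> variety_dim X"
proof -
  have "irreducible_on UNIV (coords X) \<and> infinite_generic_fibres (coords X)"
    using X
  proof
    assume "implicit_model X"
    then have "closedin zariski X" "irreducible_set zariski X"
      unfolding implicit_model_def closedin_zariski by blast+
    then show ?thesis
      by (simp add: closedin_zariski_iff irreducible_set_iff infinite_generic_fibres_closed)
  next
    assume "explicit_model TYPE('l) X"
    then obtain \<Gamma> :: "('n + 'l \<Rightarrow> 'a) set" where \<Gamma>: "irreducible_on UNIV \<Gamma>" "closure_on UNIV \<Gamma> = \<Gamma>"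
      "coords X = (\<lambda>x i. x (Inl i)) ` \<Gamma>"
      by (rule explicit_model_is_projection)
    from projection_of_closed[OF \<Gamma>(1,2)] show ?thesis unfolding \<Gamma>(3) by blast
  qed
  then show ?thesis
    using dim_le_if_generically_recoverable[of X] generically_recoverable_if_dim_le[OF _ _ s, of X]
    by blast
qed

theorem mainTheorem5:
  assumes "CARD('s::finite) \<le> CARD('n::finite)"
  shows "(\<forall>X :: (real ^ 'n) set.
            implicit_model X \<or> explicit_model TYPE('l::finite) X \<longrightarrow>
            ((\<exists>\<mu> :: real ^ 'n \<Rightarrow> real ^ 's.
                coordinate_projection \<mu> \<and> generically_recoverable X \<mu>)
              \<longleftrightarrow> enat CARD('s) \<ge> variety_dim X))
       \<and> (\<forall>X :: (complex ^ 'n) set.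
            implicit_model X \<or> explicit_model TYPE('l) X \<longrightarrow>
            ((\<exists>\<mu> :: complex ^ 'n \<Rightarrow> complex ^ 's.
                coordinate_projection \<mu> \<and> generically_recoverable X \<mu>)
              \<longleftrightarrow> enat CARD('s) \<ge> variety_dim X))"
  by (intro conjI allI impI generically_recoverable_iff_dim[OF assms])

end
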